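(* 1. The mappings $\sigma:\mathbf{NExt}(\mathbf{IntK}_\Box^R)\rightarrow\mathbf{NExt}((\mathbf{Grz}\otimes\mathbf K)\oplus\mathbf{Mix}^R)$ and $\rho:\mathbf{NExt}((\mathbf{Grz}\otimes\mathbf K)\oplus\mathbf{Mix}^R)\rightarrow\mathbf{NExt}(\mathbf{IntK}_\Box^R)$, given by $\sigma(L)=(\mathbf{Grz}\otimes\mathbf K)\oplus\mathbf{Mix}^R\oplus\{t(\Gamma/\Delta)\mid\Gamma/\Delta\in L\}$ and $\rho(M)=\{\Gamma/\Delta\mid t(\Gamma/\Delta)\in M\}$, are lattice isomorphisms and mutual inverses. 2. The mappings $\sigma:\mathbf{NExt}(\mathbf{IntK}_\Box)\rightarrow\mathbf{NExt}((\mathbf{Grz}\otimes\mathbf K)\oplus\mathbf{Mix})$ and $\rho:\mathbf{NExt}((\mathbf{Grz}\otimes\mathbf K)\oplus\mathbf{Mix})\rightarrow\mathbf{NExt}(\mathbf{IntK}_\Box)$, given by $\sigma(L)=(\mathbf{Grz}\otimes\mathbf K)\oplus\mathbf{Mix}\oplus\{t(\varphi)\mid\varphi\in L\}$ and $\rho(M)=\{\varphi\mid t(\varphi)\in M\}$, are lattice isomorphisms and mutual inverses.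
   Context: Formulas. Fix a countably infinite set $Prop$ of variables. Intuitionistic modal formulas are built with $\wedge,\vee,\rightarrow,\top,\bot,\Box$. Bimodal formulas are built with $\wedge,\vee,\neg,\top,\bot,\Box_I,\Box_M$ ($\varphi\rightarrow\psi$ is $\neg\varphi\vee\psi$). A (multi-conclusion) rule is a pair $\Gamma/\Delta$ of finite sets of formulas of the language in question; $/\varphi$ means $\emptyset/\{\varphi\}$. Logics. A bimodal logic is a set of bimodal formulas closed under substitution, containing classical propositional calculus and $\Box_i(\varphi\wedge\psi)\leftrightarrow(\Box_i\varphi\wedge\Box_i\psi)$, and closed under modus ponens, $\varphi\rightarrow\psi\Rightarrow\Box_i\varphi\rightarrow\Box_i\psi$ and $\varphi\Rightarrow\Box_i\varphi$ ($i\in\{I,M\}$). An intuitionistic modal logic is a set of intuitionistic modal formulas closed under substitution, containing intuitionistic propositional calculus and $\Box(\varphi\wedge\psi)\leftrightarrow(\Box\varphi\wedge\Box\psi)$, and closed under modus ponens, $\varphi\rightarrow\psi\Rightarrow\Box\varphi\rightarrow\Box\psi$ and $\varphi\Rightarrow\Box\varphi$. The least such logics are $\mathbf K\otimes\mathbf K$ and $\mathbf{IntK}_\Box$ respectively. $L\oplus\Delta$ is the least logic of the same kind containing $L\cup\Delta$. $\mathbf{S4}\otimes\mathbf K=(\mathbf K\otimes\mathbf K)\oplus(\Box_Ip\rightarrow p)\oplus(\Box_Ip\rightarrow\Box_I\Box_Ip)$; $\mathbf{Grz}\otimes\mathbf K=(\mathbf{S4}\otimes\mathbf K)\oplus(\Box_I(\Box_I(p\rightarrow\Box_Ip)\rightarrow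 p)\rightarrow p)$; $\mathbf{Mix}$ is the formula $\Box_I\Box_M\Box_Ip\leftrightarrow\Box_Mp$. Consequence relations. A multi-conclusion consequence relation is a set $S$ of rules closed under substitution, containing all $\varphi/\varphi$, closed under weakening ($\Gamma/\Delta\in S\Rightarrow\Gamma\cup\Gamma'/\Delta\cup\Delta'\in S$ for finite $\Gamma',\Delta'$) and cut ($\Gamma/\Delta\cup\{\varphi\},\ \Gamma\cup\{\varphi\}/\Delta\in S\Rightarrow\Gamma/\Delta\in S$). It is a bimodal (resp. intuitionistic modal) multi-conclusion consequence relation if moreover it contains $/\varphi$ for all $\varphi\in\mathbf K\otimes\mathbf K$ (resp. $\mathbf{IntK}_\Box$), $\{\varphi\rightarrow\psi,\varphi\}/\psi$, and $\varphi/\Box_I\varphi$, $\varphi/\Box_M\varphi$ (resp. $\varphi/\Box\varphi$). For a logic $L$, $L^R$ is the least such relation containing $/\varphi$ for all $\varphi\in L$; $(\mathbf{Grz}\otimes\mathbf K)\oplus\mathbf{Mix}^R$ denotes $((\mathbf{Grz}\otimes\mathbf K)\oplus\mathbf{Mix})^R$. $S\oplus\Sigma$ is the least such relation containing $S\cup\Sigma$. $\mathbf{NExt}(L)$ (for a logic or a consequence relation $L$) is the lattice of all logics (resp. consequence relations) of the same kind extending $L$, with $\oplus$ as join and intersection as meet. Gödel translation $t$ from intuitionistic modal to bimodal formulas: $t(p)=\Box_Ip$, $t(\bot)=\Box_I\bot$, $t(\top)=\Box_I\top$, $t(\varphi\circ\psi)=\Box_I(t(\varphi)\circ t(\psi))$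 for $\circ\in\{\wedge,\vee,\rightarrow\}$, $t(\Box\varphi)=\Box_I\Box_Mt(\varphi)$; $t(\Gamma/\Delta)=\{t(\gamma)\mid\gamma\in\Gamma\}/\{t(\delta)\mid\delta\in\Delta\}$. *)

theory Defs
  imports Complex_Main "HOL-Library.FSet"
begin

section \<open>Formulas\<close>

text \<open>The countably infinite set \<open>Prop\<close> of variables is \<^typ>\<open>nat\<close>.\<close>

datatype ifm =
    IVar nat
  | ITop
  | IBot
  | IAnd ifm ifm
  | IOr ifm ifm
  | IImp ifm ifm
  | IBox ifm

datatype bfm =
    BVar nat
  | BTop
  | BBot
  | BNot bfm
  | BAnd bfm bfm
  | BOr bfm bfm
  | BoxI bfm
  | BoxM bfm

abbreviation IIff :: "ifm \<Rightarrow> ifm \<Rightarrow> ifm" where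
  "IIff \<phi> \<psi> \<equiv> IAnd (IImp \<phi> \<psi>) (IImp \<psi> \<phi>)"

abbreviation BImp :: "bfm \<Rightarrow> bfm \<Rightarrow> bfm" where
  "BImp \<phi> \<psi> \<equiv> BOr (BNot \<phi>) \<psi>"

abbreviation BIff :: "bfm \<Rightarrow> bfm \<Rightarrow> bfm" where
  "BIff \<phi> \<psi> \<equiv> BAnd (BImp \<phi> \<psi>) (BImp \<psi> \<phi>)"

primrec isubst :: "(nat \<Rightarrow> ifm) \<Rightarrow> ifm \<Rightarrow> ifm" where
  "isubst s (IVar p) = s p"
| "isubst s ITop = ITop"
| "isubst s IBot = IBot"
| "isubst s (IAnd \<phi> \<psi>) = IAnd (isubst s \<phi>) (isubst s \<psi>)"
| "isubst s (IOr \<phi> \<psi>) = IOr (isubst s \<phi>) (isubst s \<psi>)"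
| "isubst s (IImp \<phi> \<psi>) = IImp (isubst s \<phi>) (isubst s \<psi>)"
| "isubst s (IBox \<phi>) = IBox (isubst s \<phi>)"

primrec bsubst :: "(nat \<Rightarrow> bfm) \<Rightarrow> bfm \<Rightarrow> bfm" where
  "bsubst s (BVar p) = s p"
| "bsubst s BTop = BTop"
| "bsubst s BBot = BBot"
| "bsubst s (BNot \<phi>) = BNot (bsubst s \<phi>)"
| "bsubst s (BAnd \<phi> \<psi>) = BAnd (bsubst s \<phi>) (bsubst s \<psi>)"
| "bsubst s (BOr \<phi> \<psi>) = BOr (bsubst s \<phi>) (bsubst s \<psi>)"
| "bsubst s (BoxI \<phi>) = BoxI (bsubst s \<phi>)"
| "bsubst s (BoxM \<phi>) = BoxM (bsubst s \<phi>)"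


section \<open>Propositional bases\<close>

text \<open>Both bases are closed under substitution of arbitrary modal formulas: the schemata of
  \<open>IPC\<close> range over all of \<^typ>\<open>ifm\<close>, and in \<open>CPC\<close> boxed subformulas act as atoms.
  As logics are closed under substitution, this is the same as requiring only the
  box-free theorems.\<close>

inductive_set IPC :: "ifm set" where
  imp_K: "IImp \<phi> (IImp \<psi> \<phi>) \<in> IPC"
| imp_S: "IImp (IImp \<phi> (IImp \<psi> \<chi>)) (IImp (IImp \<phi> \<psi>) (IImp \<phi> \<chi>)) \<in> IPC"
| and_E1: "IImp (IAnd \<phi> \<psi>) \<phi> \<in> IPC"
| and_E2: "IImp (IAnd \<phi> \<psi>) \<psi> \<in> IPC"
| and_I: "IImp \<phi> (IImp \<psi> (IAnd \<phi> \<psi>)) \<in> IPC"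
| or_I1: "IImp \<phi> (IOr \<phi> \<psi>) \<in> IPC"
| or_I2: "IImp \<psi> (IOr \<phi> \<psi>) \<in> IPC"
| or_E: "IImp (IImp \<phi> \<chi>) (IImp (IImp \<psi> \<chi>) (IImp (IOr \<phi> \<psi>) \<chi>)) \<in> IPC"
| bot_E: "IImp IBot \<phi> \<in> IPC"
| top_I: "ITop \<in> IPC"
| mp: "IImp \<phi> \<psi> \<in> IPC \<Longrightarrow> \<phi> \<in> IPC \<Longrightarrow> \<psi> \<in> IPC"

primrec ceval :: "(bfm \<Rightarrow> bool) \<Rightarrow> bfm \<Rightarrow> bool" where
  "ceval v (BVar p) \<longleftrightarrow> v (BVar p)"
| "ceval v BTop \<longleftrightarrow> True"
| "ceval v BBot \<longleftrightarrow> False"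
| "ceval v (BNot \<phi>) \<longleftrightarrow> \<not> ceval v \<phi>"
| "ceval v (BAnd \<phi> \<psi>) \<longleftrightarrow> ceval v \<phi> \<and> ceval v \<psi>"
| "ceval v (BOr \<phi> \<psi>) \<longleftrightarrow> ceval v \<phi> \<or> ceval v \<psi>"
| "ceval v (BoxI \<phi>) \<longleftrightarrow> v (BoxI \<phi>)"
| "ceval v (BoxM \<phi>) \<longleftrightarrow> v (BoxM \<phi>)"

definition CPC :: "bfm set" where
  "CPC = {\<phi>. \<forall>v. ceval v \<phi>}"


section \<open>Logics\<close>

definition int_logic :: "ifm set \<Rightarrow> bool" where
  "int_logic L \<longleftrightarrow>
     (\<forall>s. \<forall>\<phi>\<in>L. isubst s \<phi> \<in> L) \<and>
     IPC \<subseteq> L \<and>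
     (\<forall>\<phi> \<psi>. IIff (IBox (IAnd \<phi> \<psi>)) (IAnd (IBox \<phi>) (IBox \<psi>)) \<in> L) \<and>
     (\<forall>\<phi> \<psi>. IImp \<phi> \<psi> \<in> L \<longrightarrow> \<phi> \<in> L \<longrightarrow> \<psi> \<in> L) \<and>
     (\<forall>\<phi> \<psi>. IImp \<phi> \<psi> \<in> L \<longrightarrow> IImp (IBox \<phi>) (IBox \<psi>) \<in> L) \<and>
     (\<forall>\<phi>\<in>L. IBox \<phi> \<in> L)"

definition bim_logic :: "bfm set \<Rightarrow> bool" where
  "bim_logic L \<longleftrightarrow>
     (\<forall>s. \<forall>\<phi>\<in>L. bsubst s \<phi> \<in> L) \<and>
     CPC \<subseteq> L \<and>
     (\<forall>\<phi> \<psi>. BImp \<phi> \<psi> \<in> L \<longrightarrow> \<phi> \<in> L \<longrightarrow> \<psi> \<in> L) \<and>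
     (\<forall>box\<in>{BoxI, BoxM}.
        (\<forall>\<phi> \<psi>. BIff (box (BAnd \<phi> \<psi>)) (BAnd (box \<phi>) (box \<psi>)) \<in> L) \<and>
        (\<forall>\<phi> \<psi>. BImp \<phi> \<psi> \<in> L \<longrightarrow> BImp (box \<phi>) (box \<psi>) \<in> L) \<and>
        (\<forall>\<phi>\<in>L. box \<phi> \<in> L))"

text \<open>\<open>oplus P A B\<close> is the least set with property \<open>P\<close> containing \<open>A \<union> B\<close>, and \<open>NExt P L\<close> the
  set of extensions of \<open>L\<close> with property \<open>P\<close>; here \<open>P\<close> is the kind of object considered
  (intuitionistic modal or bimodal; logic or consequence relation). Each kind is closed under
  arbitrary intersections, so that \<open>P hull X\<close> is the least object of kind \<open>P\<close> containing \<open>X\<close>.\<close>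

definition oplus :: "('a set \<Rightarrow> bool) \<Rightarrow> 'a set \<Rightarrow> 'a set \<Rightarrow> 'a set" where
  "oplus P A B = P hull (A \<union> B)"

definition NExt :: "('a set \<Rightarrow> bool) \<Rightarrow> 'a set \<Rightarrow> 'a set set" where
  "NExt P L = {L'. P L' \<and> L \<subseteq> L'}"

definition IntK :: "ifm set" where
  "IntK = int_logic hull {}"

definition KK :: "bfm set" where
  "KK = bim_logic hull {}"

definition S4K :: "bfm set" where
  "S4K = oplus bim_logic
     (oplus bim_logic KK {BImp (BoxI (BVar 0)) (BVar 0)})
     {BImp (BoxI (BVar 0)) (BoxI (BoxI (BVar 0)))}"

definition GrzK :: "bfm set" where
  "GrzK = oplus bim_logic S4K
     {BImp (BoxI (BImp (BoxI (BImp (BVar 0) (BoxI (BVar 0)))) (BVar 0))) (BVar 0)}"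

definition Mix :: bfm where
  "Mix = BIff (BoxI (BoxM (BoxI (BVar 0)))) (BoxM (BVar 0))"

definition GrzKMix :: "bfm set" where
  "GrzKMix = oplus bim_logic GrzK {Mix}"


section \<open>Multi-conclusion rules and consequence relations\<close>

type_synonym 'f mrule = "'f fset \<times> 'f fset"

abbreviation map_rule :: "('f \<Rightarrow> 'g) \<Rightarrow> 'f mrule \<Rightarrow> 'g mrule" where
  "map_rule f \<equiv> map_prod (fimage f) (fimage f)"

abbreviation axiom_rule :: "'f \<Rightarrow> 'f mrule" where
  "axiom_rule \<phi> \<equiv> ({||}, {|\<phi>|})"

text \<open>The first argument is the substitution operation of the language in question.\<close>

definition mc_conseq :: "((nat \<Rightarrow> 'f) \<Rightarrow> 'f \<Rightarrow> 'f) \<Rightarrow> 'f mrule set \<Rightarrow> bool" where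
  "mc_conseq sub S \<longleftrightarrow>
     (\<forall>s. \<forall>r\<in>S. map_rule (sub s) r \<in> S) \<and>
     (\<forall>\<phi>. ({|\<phi>|}, {|\<phi>|}) \<in> S) \<and>
     (\<forall>\<Gamma> \<Delta> \<Gamma>' \<Delta>'. (\<Gamma>, \<Delta>) \<in> S \<longrightarrow> (\<Gamma> |\<union>| \<Gamma>', \<Delta> |\<union>| \<Delta>') \<in> S) \<and>
     (\<forall>\<Gamma> \<Delta> \<phi>. (\<Gamma>, \<Delta> |\<union>| {|\<phi>|}) \<in> S \<longrightarrow> (\<Gamma> |\<union>| {|\<phi>|}, \<Delta>) \<in> S \<longrightarrow> (\<Gamma>, \<Delta>) \<in> S)"

definition int_conseq :: "ifm mrule set \<Rightarrow> bool" where
  "int_conseq S \<longleftrightarrow>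
     mc_conseq isubst S \<and>
     (\<forall>\<phi>\<in>IntK. axiom_rule \<phi> \<in> S) \<and>
     (\<forall>\<phi> \<psi>. ({|IImp \<phi> \<psi>, \<phi>|}, {|\<psi>|}) \<in> S) \<and>
     (\<forall>\<phi>. ({|\<phi>|}, {|IBox \<phi>|}) \<in> S)"

definition bim_conseq :: "bfm mrule set \<Rightarrow> bool" where
  "bim_conseq S \<longleftrightarrow>
     mc_conseq bsubst S \<and>
     (\<forall>\<phi>\<in>KK. axiom_rule \<phi> \<in> S) \<and>
     (\<forall>\<phi> \<psi>. ({|BImp \<phi> \<psi>, \<phi>|}, {|\<psi>|}) \<in> S) \<and>
     (\<forall>\<phi>. ({|\<phi>|}, {|BoxI \<phi>|}) \<in> S) \<and>
     (\<forall>\<phi>. ({|\<phi>|}, {|BoxM \<phi>|}) \<in> S)"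

text \<open>\<open>logic_rel P L\<close> is \<open>L\<^sup>R\<close>, for \<open>P\<close> the corresponding kind of consequence relation.\<close>

definition logic_rel :: "('f mrule set \<Rightarrow> bool) \<Rightarrow> 'f set \<Rightarrow> 'f mrule set" where
  "logic_rel P L = P hull (axiom_rule ` L)"

definition IntK_rel :: "ifm mrule set" where
  "IntK_rel = logic_rel int_conseq IntK"

definition GrzKMix_rel :: "bfm mrule set" where
  "GrzKMix_rel = logic_rel bim_conseq GrzKMix"


section \<open>Lattice isomorphisms\<close>

definition lattice_iso ::
  "('a set \<Rightarrow> bool) \<Rightarrow> 'a set \<Rightarrow> ('b set \<Rightarrow> bool) \<Rightarrow> 'b set \<Rightarrow> ('a set \<Rightarrow> 'b set) \<Rightarrow> bool" where
  "lattice_iso P L Q M f \<longleftrightarrow>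
     bij_betw f (NExt P L) (NExt Q M) \<and>
     (\<forall>X\<in>NExt P L. \<forall>Y\<in>NExt P L.
        f (oplus P X Y) = oplus Q (f X) (f Y) \<and>
        f (X \<inter> Y) = f X \<inter> f Y)"


section \<open>Goedel translation and the maps between the lattices\<close>

primrec godel :: "ifm \<Rightarrow> bfm" where
  "godel (IVar p) = BoxI (BVar p)"
| "godel ITop = BoxI BTop"
| "godel IBot = BoxI BBot"
| "godel (IAnd \<phi> \<psi>) = BoxI (BAnd (godel \<phi>) (godel \<psi>))"
| "godel (IOr \<phi> \<psi>) = BoxI (BOr (godel \<phi>) (godel \<psi>))"
| "godel (IImp \<phi> \<psi>) = BoxI (BImp (godel \<phi>) (godel \<psi>))"
| "godel (IBox \<phi>) = BoxI (BoxM (godel \<phi>))"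

definition sigma_rel :: "ifm mrule set \<Rightarrow> bfm mrule set" where
  "sigma_rel L = oplus bim_conseq GrzKMix_rel {map_rule godel r |r. r \<in> L}"

definition rho_rel :: "bfm mrule set \<Rightarrow> ifm mrule set" where
  "rho_rel M = {r. map_rule godel r \<in> M}"

definition sigma_logic :: "ifm set \<Rightarrow> bfm set" where
  "sigma_logic L = oplus bim_logic GrzKMix {godel \<phi> |\<phi>. \<phi> \<in> L}"

definition rho_logic :: "bfm set \<Rightarrow> ifm set" where
  "rho_logic M = {\<phi>. godel \<phi> \<in> M}"

end

theory Submission
  imports Defs "HOL-Library.Countable"
begin

text \<open>
  An algebra for \<open>(Grz \<otimes> K) \<oplus> Mix\<close> is a Boolean algebra with an interior operator \<open>I\<close> and an
  operator \<open>M\<close>. Its open elements form a Heyting algebra, and the axiom \<open>Mix\<close>, which reads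
  \<open>I (M (I a)) = M a\<close>, makes \<open>M\<close> an operator that takes open values and is determined by its
  restriction to open elements. The open elements with this restriction are an algebra for
  \<open>IntK\<close>, and the Goedel translation of a formula takes in the big algebra the value of the
  formula in the algebra of open elements. The theorem says that neither passage, to the open
  elements or back, changes what is valid.

  From the bimodal side, \<open>\<sigma>(\<rho>(M)) = M\<close> has to show that whatever can be refuted can be refuted
  with values in the Boolean subalgebra generated by the open elements. This is the lemma of Blok,
  here \<open>open_generated_valuation\<close>. By the Grzegorczyk axiom every element \<open>a\<close> has the
  same closure as its part of maximal points, and that part is a Boolean combination of open
  elements (\<open>maximal_part\<close>). Given finitely many formulas, one partitions the algebra so finely that
  every block decides each of their values, and replaces the blocks by open-generated ones with the
  same closures that contain the maximal parts of the old blocks. The resulting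
  valuation gives all these formulas the same interiors as before. As \<open>M a = M (I a)\<close>, the second
  modality comes for free. The argument uses theorems of \<open>(Grz \<otimes> K) \<oplus> Mix\<close> only, so it can
  be carried out in the Lindenbaum algebra of that logic, where valuations are substitutions
  (\<open>reduction_to_godel\<close>): every formula is, up to interior, a substitution instance of a formula
  \<open>\<chi>\<close> that is, up to interior, a Goedel translation, and \<open>\<chi>\<close> is itself a substitution
  instance of the given formula. Membership of formulas and of rules can be
  carried back and forth along these substitutions.

  From the intuitionistic side, \<open>\<rho>(\<sigma>(L)) = L\<close> has to turn every theory \<open>T\<close> into a bimodal
  model. The worlds are the prime theories above \<open>T\<close>, ordered by inclusion and with the
  canonical accessibility relation, and the admissible sets of worlds are those determined by
  finitely many formulas. Such a set can be entered and left only finitely often along an increasing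
  chain of worlds, which gives the Grzegorczyk axiom (\<open>extent_Grz\<close>), and its interior is the set
  of worlds containing some single formula (\<open>interior_representable\<close>). Hence Goedel
  translations take in this model the values of intuitionistic formulas, and exactly the
  formulas in \<open>T\<close> hold everywhere.

  For logics, \<open>T\<close> is \<open>L\<close> itself. For consequence relations one uses that a rule is in the relation if
  and only if it is respected by all saturated sets of formulas (\<open>mc_conseq_if_saturated\<close>), which
  reduces rules to membership of single formulas in theories closed under modus ponens and
  necessitation.
\<close>

section \<open>Boolean subalgebras generated by sublattices\<close>

text \<open>Finite meets of clauses \<open>- a \<squnion> b\<close> with \<open>a\<close> and \<open>b\<close> from \<open>H\<close>. If \<open>H\<close> is a bounded
  sublattice, they form the Boolean subalgebra generated by \<open>H\<close>. The normal form is built into the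
  definition because an interior operator distributes over meets and turns a clause of open
  elements into their Heyting implication.\<close>

inductive_set clausal :: "'a::boolean_algebra set \<Rightarrow> 'a set" for H where
  top: "top \<in> clausal H"
| clause: "a \<in> H \<Longrightarrow> b \<in> H \<Longrightarrow> c \<in> clausal H \<Longrightarrow> inf (sup (- a) b) c \<in> clausal H"

definition bounded_sublattice :: "'a::boolean_algebra set \<Rightarrow> bool" where
  "bounded_sublattice H \<longleftrightarrow> top \<in> H \<and> bot \<in> H \<and>
     (\<forall>a\<in>H. \<forall>b\<in>H. inf a b \<in> H \<and> sup a b \<in> H)"

lemma clausal_inf:
  assumes "b \<in> clausal H" "c \<in> clausal H"
  shows "inf b c \<in> clausal H"
  using assms by (induction b) (auto simp: inf_assoc intro: clausal.intros)

lemma clause_in_clausal: "a \<in> H \<Longrightarrow> b \<in> H \<Longrightarrow> sup (- a) b \<in> clausal H"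
  using clausal.clause[OF _ _ clausal.top] by fastforce

context
  fixes H :: "'a::boolean_algebra set"
  assumes H: "bounded_sublattice H"
begin

lemma subset_clausal: "a \<in> H \<Longrightarrow> a \<in> clausal H"
  using clause_in_clausal[of top H a] H by (simp add: bounded_sublattice_def)

lemma clausal_bot: "bot \<in> clausal H"
  using H by (simp add: bounded_sublattice_def subset_clausal)

lemma uminus_in_clausal: "a \<in> H \<Longrightarrow> - a \<in> clausal H"
  using clause_in_clausal[of a H bot] H by (simp add: bounded_sublattice_def)

text \<open>A join of two clauses is again a clause, because the negative parts combine to a
  meet and the positive parts to a join in the sublattice.\<close>

lemma clausal_sup_clause:
  assumes "a \<in> H" "b \<in> H" "c \<in> clausal H"
  shows "sup (sup (- a) b) c \<in> clausal H"
  using assms(3)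
proof induction
  case top
  show ?case by (simp add: clausal.top)
next
  case (clause a' b' c)
  have "sup (sup (- a) b) (sup (- a') b') = sup (- inf a a') (sup b b')"
    by (simp add: ac_simps)
  moreover have "sup (- inf a a') (sup b b') \<in> clausal H"
    using assms clause H by (intro clause_in_clausal) (auto simp: bounded_sublattice_def)
  ultimately show ?case
    using clause by (simp only: sup_inf_distrib1 clausal_inf)
qed

lemma clausal_sup:
  assumes "b \<in> clausal H" "c \<in> clausal H"
  shows "sup b c \<in> clausal H"
  using assms(1)
  by (induction b)
    (simp_all add: sup_inf_distrib2 assms(2) clausal.top clausal_inf clausal_sup_clause)

lemma clausal_uminus:
  assumes "b \<in> clausal H"
  shows "- b \<in> clausal H"
  using assms
proof induction
  case top
  show ?case by (simp add: clausal_bot)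
next
  case (clause a b c)
  have "inf a (- b) \<in> clausal H"
    using clause by (intro clausal_inf subset_clausal uminus_in_clausal)
  then show ?case
    using clause by (simp add: clausal_sup)
qed

text \<open>The least upper bound is described by its universal property, as an arbitrary Boolean algebra
  has no operator for joins of finite families that may be empty.\<close>

lemma clausal_finite_lub:
  assumes "finite Q" "\<And>c. c \<in> Q \<Longrightarrow> f c \<in> clausal H"
  shows "\<exists>s\<in>clausal H. \<forall>z. s \<le> z \<longleftrightarrow> (\<forall>c\<in>Q. f c \<le> z)"
  using assms
proof (induction Q)
  case empty
  show ?case by (rule bexI[OF _ clausal_bot]) simp
next
  case (insert x Q)
  then obtain s where s: "s \<in> clausal H" "\<forall>z. s \<le> z \<longleftrightarrow> (\<forall>c\<in>Q. f c \<le> z)"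
    by auto
  have "sup (f x) s \<in> clausal H" using s insert.prems by (simp add: clausal_sup)
  moreover have "\<forall>z. sup (f x) s \<le> z \<longleftrightarrow> (\<forall>c\<in>insert x Q. f c \<le> z)"
    using s(2) by simp
  ultimately show ?case by blast
qed

text \<open>Disjoint lower bounds can be enlarged to disjoint blocks that jointly cover as much as the upper
  bounds do: what is not yet covered is distributed one block at a time.\<close>

lemma clausal_partition_between:
  fixes lo hi :: "'i \<Rightarrow> 'a"
  assumes "finite P"
    and "\<And>c. c \<in> P \<Longrightarrow> lo c \<in> clausal H"
    and "\<And>c. c \<in> P \<Longrightarrow> hi c \<in> clausal H"
    and "\<And>c. c \<in> P \<Longrightarrow> lo c \<le> hi c"
    and "\<And>c d. c \<in> P \<Longrightarrow> d \<in> P \<Longrightarrow> c \<noteq> d \<Longrightarrow> inf (lo c) (lo d) = bot"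
  shows "\<exists>f. (\<forall>c\<in>P. f c \<in> clausal H \<and> lo c \<le> f c \<and> f c \<le> hi c) \<and>
    (\<forall>c\<in>P. \<forall>d\<in>P. c \<noteq> d \<longrightarrow> inf (f c) (f d) = bot) \<and>
    (\<forall>z. (\<forall>c\<in>P. f c \<le> z) \<longrightarrow> (\<forall>c\<in>P. hi c \<le> z))"
  using assms
proof (induction P)
  case empty
  show ?case by simp
next
  case (insert x P)
  then obtain f where f: "\<forall>c\<in>P. f c \<in> clausal H \<and> lo c \<le> f c \<and> f c \<le> hi c"
      "\<forall>c\<in>P. \<forall>d\<in>P. c \<noteq> d \<longrightarrow> inf (f c) (f d) = bot"
      "\<forall>z. (\<forall>c\<in>P. f c \<le> z) \<longrightarrow> (\<forall>c\<in>P. hi c \<le> z)"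
    by auto
  obtain s where s: "s \<in> clausal H" "\<And>z. s \<le> z \<longleftrightarrow> (\<forall>c\<in>P. f c \<le> z)"
    using clausal_finite_lub[OF insert.hyps(1), of f] f(1) by blast
  \<comment> \<open>The new block takes its lower bound away from the old blocks, and from the rest only what
    the old blocks leave uncovered.\<close>
  define g where "g c = (if c = x then sup (lo x) (inf (hi x) (- s)) else inf (f c) (- lo x))" for c
  have gP: "g c = inf (f c) (- lo x)" if "c \<in> P" for c
    using that insert.hyps by (auto simp: g_def)
  have gx: "g x = sup (lo x) (inf (hi x) (- s))" by (simp add: g_def)
  have fs: "f c \<le> s" if "c \<in> P" for c using s(2)[of s] that by simp
  have lo_x: "lo c \<le> - lo x" if "c \<in> P" for c
    using insert.prems(4)[of c x] that insert.hyps by (auto simp: inf_shunt)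
  have "g c \<in> clausal H \<and> lo c \<le> g c \<and> g c \<le> hi c" if "c \<in> insert x P" for c
  proof (cases "c = x")
    case True
    then show ?thesis using insert.prems s(1)
      by (simp add: gx clausal_sup clausal_inf clausal_uminus)
  next
    case False
    with that have c: "c \<in> P" by simp
    then show ?thesis using insert.prems(1)[of x] f(1) lo_x[OF c]
      by (auto simp: gP intro: clausal_inf clausal_uminus le_infI1)
  qed
  moreover have disj_x: "inf (g c) (g x) = bot" if "c \<in> P" for c
  proof -
    have "g c \<le> s" using fs[OF that] gP[OF that] by (simp add: le_infI1)
    then have "g c \<le> - (inf (hi x) (- s))" by (simp add: le_supI2)
    moreover have "g c \<le> - lo x" by (simp add: gP that)
    ultimately have "g c \<le> - g x" by (simp add: gx)
    then show ?thesis by (simp add: inf_shunt)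
  qed
  moreover have disj_P: "inf (g c) (g d) = bot" if "c \<in> P" "d \<in> P" "c \<noteq> d" for c d
  proof -
    have "inf (g c) (g d) \<le> inf (f c) (f d)"
      using that by (simp add: gP le_infI1 le_infI2)
    then show ?thesis using that f(2) by (simp add: bot_unique)
  qed
  moreover have "hi c \<le> z" if z: "\<forall>c\<in>insert x P. g c \<le> z" and "c \<in> insert x P" for z c
  proof -
    have lo_z: "lo x \<le> z" and hi_z: "inf (hi x) (- s) \<le> z" using z by (simp_all add: gx)
    have "f c \<le> z" if "c \<in> P" for c
    proof -
      have "inf (f c) (- lo x) \<le> z" using z that gP by auto
      then have "f c \<le> sup (lo x) z" by (simp add: shunt1)
      then show ?thesis using lo_z by (simp add: sup_absorb2)
    qed
    then have "s \<le> z" "\<forall>c\<in>P. hi c \<le> z" using s(2) f(3) by auto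
    moreover have "hi x \<le> z"
    proof -
      have "hi x \<le> sup s z" using hi_z by (simp add: shunt1)
      then show ?thesis using \<open>s \<le> z\<close> by (simp add: sup_absorb2)
    qed
    ultimately show ?thesis using that(2) by auto
  qed
  ultimately show ?case
    by (intro exI[of _ g]) (auto simp: inf_commute)
qed

end

text \<open>The blocks are the atoms of the subalgebra generated by \<open>A\<close>, possibly together with the bottom
  element. Covering is expressed by the only upper bound being the top element.\<close>

lemma finite_partition_deciding:
  fixes A :: "'a::boolean_algebra set"
  assumes "finite A"
  shows "\<exists>P. finite P \<and> (\<forall>c\<in>P. \<forall>d\<in>P. c \<noteq> d \<longrightarrow> inf c d = bot) \<and>
    (\<forall>z. (\<forall>c\<in>P. c \<le> z) \<longrightarrow> z = top) \<and> (\<forall>a\<in>A. \<forall>c\<in>P. c \<le> a \<or> c \<le> - a)"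
  using assms
proof (induction A)
  case empty
  show ?case by (rule exI[of _ "{top}"]) (simp add: top_unique)
next
  case (insert a A)
  then obtain P where P: "finite P" "\<forall>c\<in>P. \<forall>d\<in>P. c \<noteq> d \<longrightarrow> inf c d = bot"
      "\<forall>z. (\<forall>c\<in>P. c \<le> z) \<longrightarrow> z = top" "\<forall>a\<in>A. \<forall>c\<in>P. c \<le> a \<or> c \<le> - a"
    by blast
  let ?Q = "(\<lambda>c. inf c a) ` P \<union> (\<lambda>c. inf c (- a)) ` P"
  have below: "inf c d = bot" if "c \<le> c'" "d \<le> d'" "inf c' d' = bot" for c d c' d' :: 'a
    using inf_mono[OF that(1,2)] that(3) by (simp add: bot_unique)
  have disj: "inf x y = bot" if xy: "x \<in> ?Q" "y \<in> ?Q" "x \<noteq> y" for x y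
  proof -
    from xy(1) obtain c b where c: "c \<in> P" "x = inf c b" "b = a \<or> b = - a" by blast
    from xy(2) obtain d b' where d: "d \<in> P" "y = inf d b'" "b' = a \<or> b' = - a" by blast
    have le: "x \<le> c" "x \<le> b" "y \<le> d" "y \<le> b'" using c(2) d(2) by simp_all
    show ?thesis
    proof (cases "c = d")
      case True
      then have "b \<noteq> b'" using c(2) d(2) xy(3) by blast
      then have "inf b b' = bot" using c(3) d(3) by fastforce
      then show ?thesis by (rule below[OF le(2,4)])
    next
      case False
      then have "inf c d = bot" using P(2) c(1) d(1) by blast
      then show ?thesis by (rule below[OF le(1,3)])
    qed
  qed
  have cover: "z = top" if "\<forall>x\<in>?Q. x \<le> z" for z
  proof -
    have "c \<le> z" if "c \<in> P" for c
    proof -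
      have "inf c a \<le> z" "inf c (- a) \<le> z" using \<open>\<forall>x\<in>?Q. x \<le> z\<close> that by blast+
      then have "sup (inf c a) (inf c (- a)) \<le> z" by (rule le_supI)
      moreover have "sup (inf c a) (inf c (- a)) = inf c (sup a (- a))"
        by (rule inf_sup_distrib1[symmetric])
      ultimately show ?thesis by simp
    qed
    then show ?thesis using P(3) by blast
  qed
  have decide: "x \<le> b \<or> x \<le> - b" if "b \<in> insert a A" "x \<in> ?Q" for b x
  proof -
    from that(2) obtain c where c: "c \<in> P" "x = inf c a \<or> x = inf c (- a)" by blast
    then have "x \<le> c" "x \<le> a \<or> x \<le> - a" by auto
    moreover have "b = a \<or> c \<le> b \<or> c \<le> - b" using P(4) c(1) that(1) by blast
    ultimately show ?thesis by (meson order_trans)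
  qed
  show ?case
    using P(1) disj cover decide by (intro exI[of _ ?Q] conjI ballI allI impI finite_UnI finite_imageI)
qed


section \<open>Interior algebras and Grz-algebras\<close>

locale interior_algebra =
  fixes I :: "'a::boolean_algebra \<Rightarrow> 'a"
  assumes I_top: "I top = top"
    and I_inf: "I (inf a b) = inf (I a) (I b)"
    and I_le: "I a \<le> a"
    and I_idem: "I (I a) = I a"
begin

lemma I_mono: "a \<le> b \<Longrightarrow> I a \<le> I b"
  by (metis I_inf inf.absorb_iff1)

lemma I_bot: "I bot = bot"
  using I_le[of bot] by (simp add: bot_unique)

lemma open_le_I_iff: "I a = a \<Longrightarrow> a \<le> I b \<longleftrightarrow> a \<le> b"
  by (metis I_le I_mono order_trans)

lemma I_sup_open: "I a = a \<Longrightarrow> I b = b \<Longrightarrow> I (sup a b) = sup a b"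
  by (metis I_le I_mono antisym le_sup_iff sup_ge1 sup_ge2)

lemma open_le_I_imp_iff: "I a = a \<Longrightarrow> a \<le> I (sup (- b) c) \<longleftrightarrow> inf a b \<le> c"
  by (simp add: open_le_I_iff shunt1)

lemma bounded_sublattice_open: "bounded_sublattice (range I)"
proof -
  have "a \<in> range I \<longleftrightarrow> I a = a" for a by (metis I_idem rangeE rangeI)
  then show ?thesis
    unfolding bounded_sublattice_def
    by (simp add: I_top I_bot I_inf I_sup_open)
qed

text \<open>The interior of a Boolean combination of open elements is the meet of the Heyting
  implications given by its clauses.\<close>

lemma I_clausal:
  assumes "\<And>a. a \<in> H \<Longrightarrow> I a = a" "top \<in> H"
    and "\<And>a b. a \<in> H \<Longrightarrow> b \<in> H \<Longrightarrow> inf a b \<in> H"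
    and "\<And>a b. a \<in> H \<Longrightarrow> b \<in> H \<Longrightarrow> I (sup (- a) b) \<in> H"
    and "c \<in> clausal H"
  shows "I c \<in> H"
  using assms(5) by induction (auto simp: I_top I_inf assms)

end

locale grz_algebra = interior_algebra +
  assumes Grz: "I (sup (- I (sup (- a) (I a))) a) \<le> a"
begin

text \<open>In a topological picture, \<open>m\<close> consists of the points of \<open>a\<close> above which \<open>a\<close> is
  never re-entered once left. Writing \<open>b\<close> for the complement of \<open>a\<close>, it is the open set of
  points above which every point of \<open>b\<close> is interior to \<open>b\<close>, minus the interior of
  \<open>b\<close>. The Grzegorczyk axiom says that \<open>m\<close> is cofinal in \<open>a\<close>, that is, that it has the same
  closure. Closures appear throughout as complements of interiors of complements.\<close>

lemma maximal_part:
  obtains m where "m \<in> clausal (range I)" "m \<le> a" "I (- m) = I (- a)"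
proof
  define b where "b = - a"
  let ?m = "inf (I (sup (- b) (I b))) (- I b)"
  note H = bounded_sublattice_open
  show "?m \<in> clausal (range I)"
    by (intro clausal_inf subset_clausal[OF H] uminus_in_clausal[OF H] rangeI)
  have "?m \<le> inf (sup (- b) (I b)) (- I b)" by (intro inf_mono I_le order_refl)
  also have "\<dots> \<le> - b" by (simp add: inf_sup_distrib2)
  finally show "?m \<le> a" by (simp add: b_def)
  then have "b \<le> - ?m" unfolding b_def by (rule compl_mono)
  moreover have "I (- ?m) \<le> b"
  proof -
    have "- ?m \<le> sup (- I (sup (- b) (I b))) b"
      using I_le[of b] by (simp add: le_supI2)
    from I_mono[OF this] Grz[of b] show ?thesis by (rule order_trans)
  qed
  ultimately show "I (- ?m) = I (- a)"
    by (metis I_idem I_mono antisym b_def)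
qed

end


locale grz_mix_algebra = grz_algebra I for I :: "'a::boolean_algebra \<Rightarrow> 'a" +
  fixes M :: "'a \<Rightarrow> 'a"
  assumes M_top: "M top = top"
    and M_inf: "M (inf a b) = inf (M a) (M b)"
    and Mix: "I (M (I a)) = M a"
begin

lemma M_I: "M (I a) = M a"
  by (metis I_idem Mix)

lemma I_M: "I (M a) = M a"
  by (metis M_I Mix)

end

primrec subformulas :: "bfm \<Rightarrow> bfm set" where
  "subformulas (BVar p) = {BVar p}"
| "subformulas BTop = {BTop}"
| "subformulas BBot = {BBot}"
| "subformulas (BNot \<phi>) = insert (BNot \<phi>) (subformulas \<phi>)"
| "subformulas (BAnd \<phi> \<psi>) = insert (BAnd \<phi> \<psi>) (subformulas \<phi> \<union> subformulas \<psi>)"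
| "subformulas (BOr \<phi> \<psi>) = insert (BOr \<phi> \<psi>) (subformulas \<phi> \<union> subformulas \<psi>)"
| "subformulas (BoxI \<phi>) = insert (BoxI \<phi>) (subformulas \<phi>)"
| "subformulas (BoxM \<phi>) = insert (BoxM \<phi>) (subformulas \<phi>)"

lemma finite_subformulas: "finite (subformulas \<phi>)"
  by (induction \<phi>) simp_all

primrec alg_eval ::
  "('a::boolean_algebra \<Rightarrow> 'a) \<Rightarrow> ('a \<Rightarrow> 'a) \<Rightarrow> (nat \<Rightarrow> 'a) \<Rightarrow> bfm \<Rightarrow> 'a" where
  "alg_eval I M v (BVar p) = v p"
| "alg_eval I M v BTop = top"
| "alg_eval I M v BBot = bot"
| "alg_eval I M v (BNot \<phi>) = - alg_eval I M v \<phi>"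
| "alg_eval I M v (BAnd \<phi> \<psi>) = inf (alg_eval I M v \<phi>) (alg_eval I M v \<psi>)"
| "alg_eval I M v (BOr \<phi> \<psi>) = sup (alg_eval I M v \<phi>) (alg_eval I M v \<psi>)"
| "alg_eval I M v (BoxI \<phi>) = I (alg_eval I M v \<phi>)"
| "alg_eval I M v (BoxM \<phi>) = M (alg_eval I M v \<phi>)"

text \<open>The families \<open>f\<close> and \<open>g\<close> are two partitions with the same index set, and \<open>b\<close> is built from
  blocks of \<open>g\<close> the way \<open>a\<close> is built from blocks of \<open>f\<close>. For nonzero blocks this is the graph of
  the Boolean isomorphism that matches them; a relation avoids joins over sets of blocks.\<close>

definition partition_sim ::
  "'a::boolean_algebra set \<Rightarrow> ('a \<Rightarrow> 'a) \<Rightarrow> ('a \<Rightarrow> 'a) \<Rightarrow> 'a \<Rightarrow> 'a \<Rightarrow> bool" where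
  "partition_sim P f g a b \<longleftrightarrow> (\<forall>c\<in>P. f c \<le> a \<and> g c \<le> b \<or> f c \<le> - a \<and> g c \<le> - b)"

lemma partition_sim_swap: "partition_sim P f g a b \<Longrightarrow> partition_sim P g f b a"
  by (auto simp: partition_sim_def)

lemma partition_sim_compl: "partition_sim P f g a b \<Longrightarrow> partition_sim P f g (- a) (- b)"
  by (auto simp: partition_sim_def)

lemma partition_sim_inf:
  "partition_sim P f g a b \<Longrightarrow> partition_sim P f g a' b' \<Longrightarrow>
    partition_sim P f g (inf a a') (inf b b')"
  unfolding partition_sim_def by (metis compl_inf le_inf_iff le_supI1 le_supI2)

lemma partition_sim_top: "partition_sim P f g top top"
  by (simp add: partition_sim_def)

lemma partition_sim_sup:
  assumes "partition_sim P f g a b" "partition_sim P f g a' b'"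
  shows "partition_sim P f g (sup a a') (sup b b')"
  using partition_sim_compl[OF partition_sim_inf[OF assms[THEN partition_sim_compl]]] by simp

text \<open>If matching blocks have the same closure, matching elements have the same interior. A block of
  \<open>g\<close> outside \<open>b\<close> matches a block of \<open>f\<close> disjoint from \<open>a\<close>. The closure of the latter is
  disjoint from the interior of \<open>a\<close>, and it contains the block of \<open>g\<close>.\<close>

lemma (in interior_algebra) I_le_of_partition_sim:
  assumes cover: "\<And>z. (\<forall>c\<in>P. g c \<le> z) \<Longrightarrow> z = top"
    and closure: "\<And>c. c \<in> P \<Longrightarrow> I (- f c) = I (- g c)"
    and sim: "partition_sim P f g a b"
  shows "I a \<le> I b"
proof -
  have "g c \<le> sup (- I a) b" if c: "c \<in> P" for c
  proof (cases "g c \<le> b")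
    case True
    then show ?thesis by (rule le_supI2)
  next
    case False
    then have "f c \<le> - a" using sim c by (auto simp: partition_sim_def)
    then have "a \<le> - f c" by (simp add: compl_le_swap1)
    then have "I a \<le> I (- g c)" using I_mono closure[OF c] by metis
    then have "I a \<le> - g c" using I_le order_trans by blast
    then have "g c \<le> - I a" by (simp add: compl_le_swap1)
    then show ?thesis by (rule le_supI1)
  qed
  then have "sup (- I a) b = top" using cover by blast
  then have "I a \<le> b" by (simp add: sup_shunt)
  then show ?thesis by (simp add: open_le_I_iff I_idem)
qed

text \<open>Each block \<open>c\<close> is replaced by something between its maximal part and the meet of its
  closure with an element \<open>E\<close> in the same position as \<open>c\<close> relative to the open elements in \<open>U\<close>. Both
  bounds are generated by open elements. The lower bound makes the closure of the new block at
  least that of \<open>c\<close>, the upper bound makes it at most that of \<open>c\<close> and keeps the elements of \<open>U\<close>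
  in place.\<close>

lemma (in grz_algebra) open_generated_repartition:
  assumes "finite P" and disj: "\<And>c d. c \<in> P \<Longrightarrow> d \<in> P \<Longrightarrow> c \<noteq> d \<Longrightarrow> inf c d = bot"
    and cover: "\<And>z. (\<forall>c\<in>P. c \<le> z) \<Longrightarrow> z = top"
    and "finite U" and open_U: "U \<subseteq> range I"
    and decide: "\<And>u c. u \<in> U \<Longrightarrow> c \<in> P \<Longrightarrow> c \<le> u \<or> c \<le> - u"
  obtains g where "\<And>c. c \<in> P \<Longrightarrow> g c \<in> clausal (range I)"
    and "\<And>c d. c \<in> P \<Longrightarrow> d \<in> P \<Longrightarrow> c \<noteq> d \<Longrightarrow> inf (g c) (g d) = bot"
    and "\<And>z. (\<forall>c\<in>P. g c \<le> z) \<Longrightarrow> z = top"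
    and "\<And>c. c \<in> P \<Longrightarrow> I (- c) = I (- g c)"
    and "\<And>u. u \<in> U \<Longrightarrow> partition_sim P (\<lambda>c. c) g u u"
proof -
  note H = bounded_sublattice_open
  have "\<forall>c. \<exists>m. m \<in> clausal (range I) \<and> m \<le> c \<and> I (- m) = I (- c)"
  proof
    show "\<exists>m. m \<in> clausal (range I) \<and> m \<le> c \<and> I (- m) = I (- c)" for c
      by (rule maximal_part[of c]) blast
  qed
  from choice[OF this] obtain m
    where m: "\<And>c. m c \<in> clausal (range I)" "\<And>c. m c \<le> c" "\<And>c. I (- m c) = I (- c)"
    by blast
  have ex_E: "\<exists>E. E \<in> clausal (range I) \<and> c \<le> E \<and> (\<forall>u\<in>U. c \<le> u \<and> E \<le> u \<or> c \<le> - u \<and> E \<le> - u)"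
    if c: "c \<in> P" for c
  proof -
    \<comment> \<open>The meet of the \<open>u\<close> above \<open>c\<close> and the complements of the others, all of them above \<open>c\<close>,
      is obtained as the complement of the join of the elements \<open>h u\<close>.\<close>
    define h where "h u = (if c \<le> u then - u else u)" for u
    have "h u \<in> clausal (range I)" if "u \<in> U" for u
      using that open_U by (auto simp: h_def intro: subset_clausal[OF H] uminus_in_clausal[OF H])
    then obtain s where s: "s \<in> clausal (range I)" "\<And>z. s \<le> z \<longleftrightarrow> (\<forall>u\<in>U. h u \<le> z)"
      using clausal_finite_lub[OF H \<open>finite U\<close>, of h] by blast
    have "h u \<le> - c" if "u \<in> U" for u
      using decide[OF that c] compl_le_swap1[of c u] compl_mono[of c u] by (auto simp: h_def)
    then have "c \<le> - s" using s(2) compl_le_swap1 by blast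
    moreover have "c \<le> u \<and> - s \<le> u \<or> c \<le> - u \<and> - s \<le> - u" if u: "u \<in> U" for u
    proof -
      have "h u \<le> s" using s(2)[of s] u by simp
      then show ?thesis
        using decide[OF u c] compl_le_swap2[of u s] compl_mono[of u s] by (cases "c \<le> u") (simp_all add: h_def)
    qed
    ultimately show ?thesis using clausal_uminus[OF H s(1)] by blast
  qed
  have "\<forall>c\<in>P. \<exists>E. E \<in> clausal (range I) \<and> c \<le> E \<and>
      (\<forall>u\<in>U. c \<le> u \<and> E \<le> u \<or> c \<le> - u \<and> E \<le> - u)"
    using ex_E by (rule ballI)
  from bchoice[OF this] obtain E
    where E: "\<And>c. c \<in> P \<Longrightarrow> E c \<in> clausal (range I)" "\<And>c. c \<in> P \<Longrightarrow> c \<le> E c"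
      "\<And>c u. c \<in> P \<Longrightarrow> u \<in> U \<Longrightarrow> c \<le> u \<and> E c \<le> u \<or> c \<le> - u \<and> E c \<le> - u"
    by blast
  define hi where "hi c = inf (- I (- c)) (E c)" for c
  have le_hi: "c \<le> hi c" if "c \<in> P" for c
    using E(2)[OF that] I_le[of "- c"] by (simp add: hi_def compl_le_swap1)
  have "m c \<le> hi c" if "c \<in> P" for c
    using m(2) le_hi[OF that] by (rule order_trans)
  moreover have "hi c \<in> clausal (range I)" if "c \<in> P" for c
    unfolding hi_def using E(1)[OF that] by (intro clausal_inf uminus_in_clausal[OF H] rangeI)
  moreover have "inf (m c) (m d) = bot" if "c \<in> P" "d \<in> P" "c \<noteq> d" for c d
    using inf_mono[OF m(2)[of c] m(2)[of d]] disj[OF that] by (simp add: bot_unique)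
  ultimately have "\<exists>g. (\<forall>c\<in>P. g c \<in> clausal (range I) \<and> m c \<le> g c \<and> g c \<le> hi c) \<and>
      (\<forall>c\<in>P. \<forall>d\<in>P. c \<noteq> d \<longrightarrow> inf (g c) (g d) = bot) \<and>
      (\<forall>z. (\<forall>c\<in>P. g c \<le> z) \<longrightarrow> (\<forall>c\<in>P. hi c \<le> z))"
    by (intro clausal_partition_between H \<open>finite P\<close> m(1))
  then obtain g where g: "\<forall>c\<in>P. g c \<in> clausal (range I) \<and> m c \<le> g c \<and> g c \<le> hi c"
      "\<forall>c\<in>P. \<forall>d\<in>P. c \<noteq> d \<longrightarrow> inf (g c) (g d) = bot"
      "\<forall>z. (\<forall>c\<in>P. g c \<le> z) \<longrightarrow> (\<forall>c\<in>P. hi c \<le> z)"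
    by (elim exE conjE)
  show thesis
  proof (rule that)
    show "g c \<in> clausal (range I)" if "c \<in> P" for c using g(1) that by blast
    show "inf (g c) (g d) = bot" if "c \<in> P" "d \<in> P" "c \<noteq> d" for c d using g(2) that by blast
    show "z = top" if "\<forall>c\<in>P. g c \<le> z" for z
    proof -
      have "\<forall>c\<in>P. hi c \<le> z" using g(3) that by blast
      then have "\<forall>c\<in>P. c \<le> z" using le_hi order_trans by fast
      then show ?thesis by (rule cover)
    qed
    show "I (- c) = I (- g c)" if c: "c \<in> P" for c
    proof (rule antisym)
      have "g c \<le> - I (- c)" using g(1) c by (auto simp: hi_def)
      then have "I (- c) \<le> - g c" by (simp add: compl_le_swap1)
      then show "I (- c) \<le> I (- g c)" by (simp add: open_le_I_iff I_idem)
      have "- g c \<le> - m c" using g(1) c by simp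
      then show "I (- g c) \<le> I (- c)" using m(3) I_mono by metis
    qed
    show "partition_sim P (\<lambda>c. c) g u u" if "u \<in> U" for u
      unfolding partition_sim_def
    proof
      fix c assume c: "c \<in> P"
      have "g c \<le> E c" using g(1) c by (auto simp: hi_def)
      then show "c \<le> u \<and> g c \<le> u \<or> c \<le> - u \<and> g c \<le> - u"
        using E(3)[OF c that] order_trans[of "g c" "E c"] by auto
    qed
  qed
qed

text \<open>The blocks decide the values of all subformulas. The values of boxed formulas are open, by \<open>Mix\<close>
  also for the second modality, so the new partition is required to keep them. By
  induction, old and new values of subformulas then consist of matching blocks, hence have
  the same interior, and for boxed formulas they even coincide.\<close>

theorem (in grz_mix_algebra) open_generated_valuation:
  assumes "finite \<Theta>"
  obtains w where "\<And>p. w p \<in> clausal (range I)"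
    and "\<And>\<phi>. \<phi> \<in> \<Theta> \<Longrightarrow> I (alg_eval I M w \<phi>) = I (alg_eval I M v \<phi>)"
proof -
  note H = bounded_sublattice_open
  define S where "S = (\<Union>\<phi>\<in>\<Theta>. subformulas \<phi>)"
  \<comment> \<open>Subformulas are included so that the induction below can treat every one of them.\<close>
  define A where "A = alg_eval I M v ` S"
  have "finite A" by (simp add: A_def S_def assms finite_subformulas)
  then obtain P where P: "finite P" "\<forall>c\<in>P. \<forall>d\<in>P. c \<noteq> d \<longrightarrow> inf c d = bot"
      "\<forall>z. (\<forall>c\<in>P. c \<le> z) \<longrightarrow> z = top" "\<forall>a\<in>A. \<forall>c\<in>P. c \<le> a \<or> c \<le> - a"
    using finite_partition_deciding[of A] by blast
  have "finite (A \<inter> range I)" using \<open>finite A\<close> by simp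
  moreover have "inf c d = bot" if "c \<in> P" "d \<in> P" "c \<noteq> d" for c d
    using P(2) that by blast
  moreover have "z = top" if "\<forall>c\<in>P. c \<le> z" for z
    using P(3) that by blast
  moreover have "c \<le> u \<or> c \<le> - u" if "u \<in> A \<inter> range I" "c \<in> P" for u c
    using P(4) that by blast
  ultimately obtain g where g: "\<And>c. c \<in> P \<Longrightarrow> g c \<in> clausal (range I)"
    "\<And>c d. c \<in> P \<Longrightarrow> d \<in> P \<Longrightarrow> c \<noteq> d \<Longrightarrow> inf (g c) (g d) = bot"
    "\<And>z. (\<forall>c\<in>P. g c \<le> z) \<Longrightarrow> z = top"
    "\<And>c. c \<in> P \<Longrightarrow> I (- c) = I (- g c)"
    "\<And>u. u \<in> A \<inter> range I \<Longrightarrow> partition_sim P (\<lambda>c. c) g u u"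
    using open_generated_repartition[OF P(1) _ _ _ Int_lower2] by blast
  have "\<exists>s\<in>clausal (range I). \<forall>z. s \<le> z \<longleftrightarrow> (\<forall>c\<in>{c \<in> P. c \<le> v p}. g c \<le> z)" for p
    using g(1) P(1) by (intro clausal_finite_lub[OF H]) simp_all
  then have "\<forall>p. \<exists>s. s \<in> clausal (range I) \<and> (\<forall>z. s \<le> z \<longleftrightarrow> (\<forall>c\<in>{c \<in> P. c \<le> v p}. g c \<le> z))"
    by blast
  from choice[OF this] obtain w where w: "\<And>p. w p \<in> clausal (range I)"
      "\<And>p z. w p \<le> z \<longleftrightarrow> (\<forall>c\<in>{c \<in> P. c \<le> v p}. g c \<le> z)"
    by blast
  have sim_var: "partition_sim P (\<lambda>c. c) g (v p) (w p)" if "v p \<in> A" for p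
    unfolding partition_sim_def
  proof
    fix c assume c: "c \<in> P"
    show "c \<le> v p \<and> g c \<le> w p \<or> c \<le> - v p \<and> g c \<le> - w p"
    proof (cases "c \<le> v p")
      case True
      then show ?thesis using w(2)[of p "w p"] c by simp
    next
      case False
      then have "c \<le> - v p" using P(4) c that by blast
      moreover have "g d \<le> - g c" if "d \<in> P" "d \<le> v p" for d
        using g(2)[OF that(1) c] that(2) False by (auto simp: inf_shunt)
      then have "w p \<le> - g c" using w(2) by blast
      then have "g c \<le> - w p" by (simp add: compl_le_swap1)
      ultimately show ?thesis by blast
    qed
  qed
  have I_eq: "I a = I b" if "partition_sim P (\<lambda>c. c) g a b" for a b
  proof (rule antisym)
    show "I a \<le> I b"
      by (rule I_le_of_partition_sim[OF _ _ that]) (use g(3,4) in auto)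
    show "I b \<le> I a"
      by (rule I_le_of_partition_sim[OF _ _ partition_sim_swap[OF that]]) (use g(4) P(3) in auto)
  qed
  have sim: "partition_sim P (\<lambda>c. c) g (alg_eval I M v \<phi>) (alg_eval I M w \<phi>)" if "subformulas \<phi> \<subseteq> S" for \<phi>
    using that
  proof (induction \<phi>)
    case (BVar p)
    then have "v p \<in> A" by (force simp: A_def)
    then show ?case by (simp only: alg_eval.simps sim_var)
  next
    case BTop
    show ?case by (simp only: alg_eval.simps partition_sim_top)
  next
    case BBot
    show ?case using partition_sim_compl[OF partition_sim_top] by simp
  next
    case (BoxI \<phi>)
    then have "I (alg_eval I M v \<phi>) \<in> A" by (force simp: A_def)
    moreover have "I (alg_eval I M v \<phi>) = I (alg_eval I M w \<phi>)"
      using BoxI by (intro I_eq) simp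
    ultimately show ?case using g(5)[of "I (alg_eval I M v \<phi>)"] by simp
  next
    case (BoxM \<phi>)
    then have "M (alg_eval I M v \<phi>) \<in> A" by (force simp: A_def)
    moreover have "M (alg_eval I M v \<phi>) \<in> range I" by (metis I_M rangeI)
    moreover have "I (alg_eval I M v \<phi>) = I (alg_eval I M w \<phi>)"
      using BoxM by (intro I_eq) simp
    then have "M (alg_eval I M v \<phi>) = M (alg_eval I M w \<phi>)" by (metis M_I)
    ultimately show ?case using g(5)[of "M (alg_eval I M v \<phi>)"] by simp
  qed (simp_all add: partition_sim_compl partition_sim_inf partition_sim_sup)
  show thesis
  proof (rule that[of w])
    show "I (alg_eval I M w \<phi>) = I (alg_eval I M v \<phi>)" if "\<phi> \<in> \<Theta>" for \<phi>
      using that by (intro I_eq[symmetric] sim) (auto simp: S_def)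
  qed (rule w(1))
qed


section \<open>Logics and generated extensions\<close>

lemma bim_logicD:
  assumes "bim_logic L"
  shows bim_logic_subst: "\<phi> \<in> L \<Longrightarrow> bsubst s \<phi> \<in> L"
    and bim_logic_CPC: "CPC \<subseteq> L"
    and bim_logic_mp: "BImp \<phi> \<psi> \<in> L \<Longrightarrow> \<phi> \<in> L \<Longrightarrow> \<psi> \<in> L"
    and bim_logic_I_and: "BIff (BoxI (BAnd \<phi> \<psi>)) (BAnd (BoxI \<phi>) (BoxI \<psi>)) \<in> L"
    and bim_logic_M_and: "BIff (BoxM (BAnd \<phi> \<psi>)) (BAnd (BoxM \<phi>) (BoxM \<psi>)) \<in> L"
    and bim_logic_I_mono: "BImp \<phi> \<psi> \<in> L \<Longrightarrow> BImp (BoxI \<phi>) (BoxI \<psi>) \<in> L"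
    and bim_logic_M_mono: "BImp \<phi> \<psi> \<in> L \<Longrightarrow> BImp (BoxM \<phi>) (BoxM \<psi>) \<in> L"
    and bim_logic_I_nec: "\<phi> \<in> L \<Longrightarrow> BoxI \<phi> \<in> L"
    and bim_logic_M_nec: "\<phi> \<in> L \<Longrightarrow> BoxM \<phi> \<in> L"
  using assms unfolding bim_logic_def by blast+

lemma bim_logicI:
  assumes "\<And>s \<phi>. \<phi> \<in> L \<Longrightarrow> bsubst s \<phi> \<in> L"
    and "CPC \<subseteq> L"
    and "\<And>\<phi> \<psi>. BImp \<phi> \<psi> \<in> L \<Longrightarrow> \<phi> \<in> L \<Longrightarrow> \<psi> \<in> L"
    and "\<And>\<phi> \<psi>. BIff (BoxI (BAnd \<phi> \<psi>)) (BAnd (BoxI \<phi>) (BoxI \<psi>)) \<in> L"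
    and "\<And>\<phi> \<psi>. BIff (BoxM (BAnd \<phi> \<psi>)) (BAnd (BoxM \<phi>) (BoxM \<psi>)) \<in> L"
    and "\<And>\<phi> \<psi>. BImp \<phi> \<psi> \<in> L \<Longrightarrow> BImp (BoxI \<phi>) (BoxI \<psi>) \<in> L"
    and "\<And>\<phi> \<psi>. BImp \<phi> \<psi> \<in> L \<Longrightarrow> BImp (BoxM \<phi>) (BoxM \<psi>) \<in> L"
    and "\<And>\<phi>. \<phi> \<in> L \<Longrightarrow> BoxI \<phi> \<in> L"
    and "\<And>\<phi>. \<phi> \<in> L \<Longrightarrow> BoxM \<phi> \<in> L"
  shows "bim_logic L"
  unfolding bim_logic_def using assms by simp

lemma int_logicD:
  assumes "int_logic L"
  shows int_logic_subst: "\<phi> \<in> L \<Longrightarrow> isubst s \<phi> \<in> L"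
    and int_logic_IPC: "IPC \<subseteq> L"
    and int_logic_Box_and: "IIff (IBox (IAnd \<phi> \<psi>)) (IAnd (IBox \<phi>) (IBox \<psi>)) \<in> L"
    and int_logic_mp: "IImp \<phi> \<psi> \<in> L \<Longrightarrow> \<phi> \<in> L \<Longrightarrow> \<psi> \<in> L"
    and int_logic_Box_mono: "IImp \<phi> \<psi> \<in> L \<Longrightarrow> IImp (IBox \<phi>) (IBox \<psi>) \<in> L"
    and int_logic_nec: "\<phi> \<in> L \<Longrightarrow> IBox \<phi> \<in> L"
  using assms unfolding int_logic_def by blast+

lemma int_logicI:
  assumes "\<And>s \<phi>. \<phi> \<in> L \<Longrightarrow> isubst s \<phi> \<in> L"
    and "IPC \<subseteq> L"
    and "\<And>\<phi> \<psi>. IIff (IBox (IAnd \<phi> \<psi>)) (IAnd (IBox \<phi>) (IBox \<psi>)) \<in> L"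
    and "\<And>\<phi> \<psi>. IImp \<phi> \<psi> \<in> L \<Longrightarrow> \<phi> \<in> L \<Longrightarrow> \<psi> \<in> L"
    and "\<And>\<phi> \<psi>. IImp \<phi> \<psi> \<in> L \<Longrightarrow> IImp (IBox \<phi>) (IBox \<psi>) \<in> L"
    and "\<And>\<phi>. \<phi> \<in> L \<Longrightarrow> IBox \<phi> \<in> L"
  shows "int_logic L"
  unfolding int_logic_def using assms by simp

lemma bim_logic_Inter:
  assumes "\<And>L. L \<in> \<L> \<Longrightarrow> bim_logic L"
  shows "bim_logic (\<Inter>\<L>)"
  by (rule bim_logicI; (intro InterI Inter_greatest)?; frule assms)
    (simp_all add: bim_logicD, blast intro: bim_logic_mp)

lemma int_logic_Inter:
  assumes "\<And>L. L \<in> \<L> \<Longrightarrow> int_logic L"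
  shows "int_logic (\<Inter>\<L>)"
  by (rule int_logicI; (intro InterI Inter_greatest)?; frule assms)
    (simp_all add: int_logicD, blast intro: int_logic_mp)

lemma bim_logic_hull: "bim_logic (bim_logic hull X)"
  by (rule hull_in) (simp add: bim_logic_Inter)

lemma int_logic_hull: "int_logic (int_logic hull X)"
  by (rule hull_in) (simp add: int_logic_Inter)

lemma int_logic_IntK: "int_logic IntK"
  unfolding IntK_def by (rule int_logic_hull)

lemma oplus_bim_logic_subset_iff:
  "bim_logic L \<Longrightarrow> oplus bim_logic A B \<subseteq> L \<longleftrightarrow> A \<subseteq> L \<and> B \<subseteq> L"
  unfolding oplus_def by (metis hull_minimal hull_subset le_sup_iff order_trans)

lemma GrzKMix_subset_iff:
  assumes "bim_logic L"
  shows "GrzKMix \<subseteq> L \<longleftrightarrow> BImp (BoxI (BVar 0)) (BVar 0) \<in> L \<and>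
    BImp (BoxI (BVar 0)) (BoxI (BoxI (BVar 0))) \<in> L \<and>
    BImp (BoxI (BImp (BoxI (BImp (BVar 0) (BoxI (BVar 0)))) (BVar 0))) (BVar 0) \<in> L \<and>
    Mix \<in> L"
proof -
  have "KK \<subseteq> L" unfolding KK_def by (rule hull_minimal) (simp_all add: assms)
  then show ?thesis
    unfolding GrzKMix_def GrzK_def S4K_def by (simp add: oplus_bim_logic_subset_iff[OF assms] conj_assoc)
qed


section \<open>The Lindenbaum algebra\<close>

lemma bim_logic_GrzKMix: "bim_logic GrzKMix"
  unfolding GrzKMix_def oplus_def by (rule bim_logic_hull)

lemma GrzKMix_axioms:
  shows GrzKMix_T: "BImp (BoxI \<phi>) \<phi> \<in> GrzKMix"
    and GrzKMix_4: "BImp (BoxI \<phi>) (BoxI (BoxI \<phi>)) \<in> GrzKMix"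
    and GrzKMix_Grz: "BImp (BoxI (BImp (BoxI (BImp \<phi> (BoxI \<phi>))) \<phi>)) \<phi> \<in> GrzKMix"
    and GrzKMix_Mix: "BIff (BoxI (BoxM (BoxI \<phi>))) (BoxM \<phi>) \<in> GrzKMix"
proof -
  have ax: "BImp (BoxI (BVar 0)) (BVar 0) \<in> GrzKMix"
    "BImp (BoxI (BVar 0)) (BoxI (BoxI (BVar 0))) \<in> GrzKMix"
    "BImp (BoxI (BImp (BoxI (BImp (BVar 0) (BoxI (BVar 0)))) (BVar 0))) (BVar 0) \<in> GrzKMix"
    "BIff (BoxI (BoxM (BoxI (BVar 0)))) (BoxM (BVar 0)) \<in> GrzKMix"
    using GrzKMix_subset_iff[OF bim_logic_GrzKMix] unfolding Mix_def by blast+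
  show "BImp (BoxI \<phi>) \<phi> \<in> GrzKMix"
    using bim_logic_subst[OF bim_logic_GrzKMix ax(1), of "\<lambda>_. \<phi>"] by simp
  show "BImp (BoxI \<phi>) (BoxI (BoxI \<phi>)) \<in> GrzKMix"
    using bim_logic_subst[OF bim_logic_GrzKMix ax(2), of "\<lambda>_. \<phi>"] by simp
  show "BImp (BoxI (BImp (BoxI (BImp \<phi> (BoxI \<phi>))) \<phi>)) \<phi> \<in> GrzKMix"
    using bim_logic_subst[OF bim_logic_GrzKMix ax(3), of "\<lambda>_. \<phi>"] by simp
  show "BIff (BoxI (BoxM (BoxI \<phi>))) (BoxM \<phi>) \<in> GrzKMix"
    using bim_logic_subst[OF bim_logic_GrzKMix ax(4), of "\<lambda>_. \<phi>"] by simp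
qed

text \<open>Membership in the logic of formulas that follow propositionally from zero, one or two
  members is reduced to two-valued evaluation.\<close>

lemma GrzKMix_cpc:
  assumes "\<And>v. ceval v \<phi>"
  shows "\<phi> \<in> GrzKMix"
proof -
  have "\<phi> \<in> CPC" using assms by (simp add: CPC_def)
  then show ?thesis using bim_logic_CPC[OF bim_logic_GrzKMix] by (rule rev_subsetD)
qed

lemma GrzKMix_cpc1:
  assumes "\<phi> \<in> GrzKMix" "\<And>v. ceval v \<phi> \<Longrightarrow> ceval v \<psi>"
  shows "\<psi> \<in> GrzKMix"
proof (rule bim_logic_mp[OF bim_logic_GrzKMix GrzKMix_cpc assms(1)])
  show "ceval v (BImp \<phi> \<psi>)" for v using assms(2)[of v] by auto
qed

lemma GrzKMix_cpc2:
  assumes "\<phi> \<in> GrzKMix" "\<psi> \<in> GrzKMix" "\<And>v. ceval v \<phi> \<Longrightarrow> ceval v \<psi> \<Longrightarrow> ceval v \<chi>"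
  shows "\<chi> \<in> GrzKMix"
proof (rule bim_logic_mp[OF bim_logic_GrzKMix GrzKMix_cpc1[OF assms(1)] assms(2)])
  show "ceval v (BImp \<psi> \<chi>)" if "ceval v \<phi>" for v using assms(3)[of v] that by auto
qed

text \<open>Every extension of the logic respects this one equivalence, so a single quotient serves all
  the logics and consequence relations considered.\<close>

definition GrzKMix_equiv :: "bfm \<Rightarrow> bfm \<Rightarrow> bool" where
  "GrzKMix_equiv \<phi> \<psi> \<longleftrightarrow> BIff \<phi> \<psi> \<in> GrzKMix"

lemma GrzKMix_equiv_refl: "GrzKMix_equiv \<phi> \<phi>"
  unfolding GrzKMix_equiv_def by (rule GrzKMix_cpc, unfold ceval.simps, blast)

lemma GrzKMix_equiv_sym: "GrzKMix_equiv \<phi> \<psi> \<Longrightarrow> GrzKMix_equiv \<psi> \<phi>"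
  unfolding GrzKMix_equiv_def by (erule GrzKMix_cpc1, unfold ceval.simps, blast)

lemma GrzKMix_equiv_trans:
  "GrzKMix_equiv \<phi> \<psi> \<Longrightarrow> GrzKMix_equiv \<psi> \<chi> \<Longrightarrow> GrzKMix_equiv \<phi> \<chi>"
  unfolding GrzKMix_equiv_def by (erule (1) GrzKMix_cpc2, unfold ceval.simps, blast)

quotient_type lind = bfm / GrzKMix_equiv
  by (rule equivpI[OF reflpI sympI transpI])
    (fact GrzKMix_equiv_refl GrzKMix_equiv_sym GrzKMix_equiv_trans)+

instantiation lind :: boolean_algebra
begin

lift_definition less_eq_lind :: "lind \<Rightarrow> lind \<Rightarrow> bool" is "\<lambda>\<phi> \<psi>. BImp \<phi> \<psi> \<in> GrzKMix"
proof -
  have "BImp \<phi>' \<psi>' \<in> GrzKMix"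
    if "GrzKMix_equiv \<phi> \<phi>'" "GrzKMix_equiv \<psi> \<psi>'" "BImp \<phi> \<psi> \<in> GrzKMix" for \<phi> \<phi>' \<psi> \<psi>'
  proof -
    have "BImp \<phi>' \<psi> \<in> GrzKMix"
      using that(1,3) unfolding GrzKMix_equiv_def by (rule GrzKMix_cpc2, unfold ceval.simps, blast)
    then show ?thesis using that(2) unfolding GrzKMix_equiv_def by (rule GrzKMix_cpc2, unfold ceval.simps, blast)
  qed
  moreover have "GrzKMix_equiv \<psi> \<phi>" if "GrzKMix_equiv \<phi> \<psi>" for \<phi> \<psi>
    using that unfolding GrzKMix_equiv_def by (rule GrzKMix_cpc1, unfold ceval.simps, blast)
  ultimately show "GrzKMix_equiv \<phi> \<phi>' \<Longrightarrow> GrzKMix_equiv \<psi> \<psi>' \<Longrightarrow>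
      (BImp \<phi> \<psi> \<in> GrzKMix) = (BImp \<phi>' \<psi>' \<in> GrzKMix)" for \<phi> \<phi>' \<psi> \<psi>'
    by blast
qed

definition less_lind :: "lind \<Rightarrow> lind \<Rightarrow> bool" where
  "less_lind a b \<longleftrightarrow> a \<le> b \<and> \<not> b \<le> a"

lift_definition inf_lind :: "lind \<Rightarrow> lind \<Rightarrow> lind" is BAnd
  unfolding GrzKMix_equiv_def by (erule (1) GrzKMix_cpc2, unfold ceval.simps, blast)

lift_definition sup_lind :: "lind \<Rightarrow> lind \<Rightarrow> lind" is BOr
  unfolding GrzKMix_equiv_def by (erule (1) GrzKMix_cpc2, unfold ceval.simps, blast)

lift_definition uminus_lind :: "lind \<Rightarrow> lind" is BNot
  unfolding GrzKMix_equiv_def by (erule GrzKMix_cpc1, unfold ceval.simps, blast)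

definition minus_lind :: "lind \<Rightarrow> lind \<Rightarrow> lind" where
  "minus_lind a b = inf a (- b)"

lift_definition top_lind :: lind is BTop .

lift_definition bot_lind :: lind is BBot .

instance
proof
  fix x y z :: lind
  show "x < y \<longleftrightarrow> x \<le> y \<and> \<not> y \<le> x" by (rule less_lind_def)
  show "x - y = inf x (- y)" by (rule minus_lind_def)
  show "x \<le> x" "inf x y \<le> x" "inf x y \<le> y" "x \<le> sup x y" "y \<le> sup x y" "bot \<le> x" "x \<le> top"
    by (transfer, rule GrzKMix_cpc, unfold ceval.simps, blast)+
  show "sup x (inf y z) = inf (sup x y) (sup x z)" "inf x (- x) = bot" "sup x (- x) = top"
    by (transfer, unfold GrzKMix_equiv_def, rule GrzKMix_cpc, unfold ceval.simps, blast)+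
  show "x \<le> z" if "x \<le> y" "y \<le> z"
    using that by transfer (erule (1) GrzKMix_cpc2, unfold ceval.simps, blast)
  show "x = y" if "x \<le> y" "y \<le> x"
    using that by transfer (unfold GrzKMix_equiv_def, erule (1) GrzKMix_cpc2, unfold ceval.simps, blast)
  show "x \<le> inf y z" if "x \<le> y" "x \<le> z"
    using that by transfer (erule (1) GrzKMix_cpc2, unfold ceval.simps, blast)
  show "sup y z \<le> x" if "y \<le> x" "z \<le> x"
    using that by transfer (erule (1) GrzKMix_cpc2, unfold ceval.simps, blast)
qed

end

lift_definition lind_I :: "lind \<Rightarrow> lind" is BoxI
  unfolding GrzKMix_equiv_def
proof -
  fix \<phi> \<psi> assume "BIff \<phi> \<psi> \<in> GrzKMix"
  then have imp: "BImp \<phi> \<psi> \<in> GrzKMix" "BImp \<psi> \<phi> \<in> GrzKMix"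
    by (rule GrzKMix_cpc1, unfold ceval.simps, blast)+
  show "BIff (BoxI \<phi>) (BoxI \<psi>) \<in> GrzKMix"
    by (rule GrzKMix_cpc2[OF imp[THEN bim_logic_I_mono[OF bim_logic_GrzKMix]]], unfold ceval.simps, blast)
qed

lift_definition lind_M :: "lind \<Rightarrow> lind" is BoxM
  unfolding GrzKMix_equiv_def
proof -
  fix \<phi> \<psi> assume "BIff \<phi> \<psi> \<in> GrzKMix"
  then have imp: "BImp \<phi> \<psi> \<in> GrzKMix" "BImp \<psi> \<phi> \<in> GrzKMix"
    by (rule GrzKMix_cpc1, unfold ceval.simps, blast)+
  show "BIff (BoxM \<phi>) (BoxM \<psi>) \<in> GrzKMix"
    by (rule GrzKMix_cpc2[OF imp[THEN bim_logic_M_mono[OF bim_logic_GrzKMix]]], unfold ceval.simps, blast)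
qed

lemma abs_lind_eq_iff: "abs_lind \<phi> = abs_lind \<psi> \<longleftrightarrow> BIff \<phi> \<psi> \<in> GrzKMix"
  by (simp add: lind.abs_eq_iff GrzKMix_equiv_def)

lemma abs_lind_eq_top_iff: "abs_lind \<phi> = top \<longleftrightarrow> \<phi> \<in> GrzKMix"
proof -
  have "BIff \<phi> BTop \<in> GrzKMix \<longleftrightarrow> \<phi> \<in> GrzKMix"
    by (intro iffI; erule GrzKMix_cpc1; unfold ceval.simps; blast)
  then show ?thesis by (simp only: top_lind.abs_eq abs_lind_eq_iff)
qed

lemmas abs_lind_simps = inf_lind.abs_eq sup_lind.abs_eq uminus_lind.abs_eq top_lind.abs_eq
  bot_lind.abs_eq lind_I.abs_eq lind_M.abs_eq

interpretation lind: grz_mix_algebra lind_I lind_M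
proof
  fix a b :: lind
  show "lind_I top = top" "lind_M top = top"
    unfolding top_lind.abs_eq lind_I.abs_eq lind_M.abs_eq abs_lind_eq_top_iff[unfolded top_lind.abs_eq]
    by (intro bim_logic_I_nec[OF bim_logic_GrzKMix] bim_logic_M_nec[OF bim_logic_GrzKMix] GrzKMix_cpc; simp)+
  show "lind_I (inf a b) = inf (lind_I a) (lind_I b)"
    by transfer (unfold GrzKMix_equiv_def, rule bim_logic_I_and[OF bim_logic_GrzKMix])
  show "lind_M (inf a b) = inf (lind_M a) (lind_M b)"
    by transfer (unfold GrzKMix_equiv_def, rule bim_logic_M_and[OF bim_logic_GrzKMix])
  show "lind_I a \<le> a"
    by transfer (rule GrzKMix_T)
  show "lind_I (lind_I a) = lind_I a"
  proof (transfer, unfold GrzKMix_equiv_def)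
    show "BIff (BoxI (BoxI \<phi>)) (BoxI \<phi>) \<in> GrzKMix" for \<phi>
      by (rule GrzKMix_cpc2[OF GrzKMix_T[of "BoxI \<phi>"] GrzKMix_4[of \<phi>]], unfold ceval.simps, blast)
  qed
  show "lind_I (sup (- lind_I (sup (- a) (lind_I a))) a) \<le> a"
    by transfer (rule GrzKMix_Grz)
  show "lind_I (lind_M (lind_I a)) = lind_M a"
    by transfer (unfold GrzKMix_equiv_def, rule GrzKMix_Mix)
qed

abbreviation lind_eval :: "(nat \<Rightarrow> lind) \<Rightarrow> bfm \<Rightarrow> lind" where
  "lind_eval \<equiv> alg_eval lind_I lind_M"

text \<open>In the Lindenbaum algebra, valuations are substitutions up to provable equivalence.\<close>

lemma abs_lind_bsubst: "abs_lind (bsubst s \<phi>) = lind_eval (\<lambda>p. abs_lind (s p)) \<phi>"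
  by (induction \<phi>) (simp_all flip: abs_lind_simps)

lemma bsubst_BVar: "bsubst BVar \<phi> = \<phi>"
  by (induction \<phi>) simp_all

lemma alg_eval_bsubst: "alg_eval I M v (bsubst s \<phi>) = alg_eval I M (\<lambda>p. alg_eval I M v (s p)) \<phi>"
  by (induction \<phi>) simp_all


section \<open>The Goedel translation in the Lindenbaum algebra\<close>

definition lind_godel :: "ifm \<Rightarrow> lind" where
  "lind_godel \<phi> = abs_lind (godel \<phi>)"

lemma lind_godel_simps:
  "lind_godel (IVar p) = lind_I (abs_lind (BVar p))"
  "lind_godel ITop = top"
  "lind_godel IBot = bot"
  "lind_godel (IAnd \<phi> \<psi>) = inf (lind_godel \<phi>) (lind_godel \<psi>)"
  "lind_godel (IOr \<phi> \<psi>) = sup (lind_godel \<phi>) (lind_godel \<psi>)"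
  "lind_godel (IImp \<phi> \<psi>) = lind_I (sup (- lind_godel \<phi>) (lind_godel \<psi>))"
  "lind_godel (IBox \<phi>) = lind_M (lind_godel \<phi>)"
  and lind_godel_open: "lind_I (lind_godel \<phi>) = lind_godel \<phi>"
proof -
  show op: "lind_I (lind_godel \<phi>) = lind_godel \<phi>" for \<phi>
    by (cases \<phi>) (simp_all flip: abs_lind_simps add: lind_godel_def lind.I_idem)
  show "lind_godel (IVar p) = lind_I (abs_lind (BVar p))"
    "lind_godel ITop = top"
    "lind_godel IBot = bot"
    "lind_godel (IAnd \<phi> \<psi>) = inf (lind_godel \<phi>) (lind_godel \<psi>)"
    "lind_godel (IOr \<phi> \<psi>) = sup (lind_godel \<phi>) (lind_godel \<psi>)"
    "lind_godel (IImp \<phi> \<psi>) = lind_I (sup (- lind_godel \<phi>) (lind_godel \<psi>))"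
    "lind_godel (IBox \<phi>) = lind_M (lind_godel \<phi>)" for p \<phi> \<psi>
    by (simp_all flip: abs_lind_simps
      add: lind_godel_def op[unfolded lind_godel_def] lind.I_top lind.I_bot lind.I_inf lind.I_sup_open lind.I_M)
qed

lemma lind_godel_isubst: "lind_godel (isubst s \<phi>) = abs_lind (bsubst (\<lambda>p. godel (s p)) (godel \<phi>))"
proof -
  have "abs_lind (bsubst (\<lambda>p. godel (s p)) (godel \<phi>)) = lind_eval (\<lambda>p. lind_godel (s p)) (godel \<phi>)"
    unfolding lind_godel_def by (rule abs_lind_bsubst)
  also have "\<dots> = lind_godel (isubst s \<phi>)"
    by (induction \<phi>) (simp_all add: lind_godel_simps lind_godel_open
        lind.I_top lind.I_bot lind.I_inf lind.I_sup_open lind.I_M)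
  finally show ?thesis ..
qed

text \<open>The translations of formulas are open, so their values obey the adjunction between meet and
  Heyting implication; every axiom of \<open>IPC\<close> becomes an inequality.\<close>

lemma lind_godel_imp_top: "lind_godel (IImp \<phi> \<psi>) = top \<longleftrightarrow> lind_godel \<phi> \<le> lind_godel \<psi>"
  using lind.open_le_I_imp_iff[of top "lind_godel \<phi>" "lind_godel \<psi>"]
  by (simp add: lind_godel_simps top_unique lind.I_top)

lemma le_lind_godel_imp:
  "lind_I a = a \<Longrightarrow> a \<le> lind_godel (IImp \<phi> \<psi>) \<longleftrightarrow> inf a (lind_godel \<phi>) \<le> lind_godel \<psi>"
  by (simp add: lind_godel_simps lind.open_le_I_imp_iff)

lemma lind_godel_mp: "inf (lind_godel (IImp \<phi> \<psi>)) (lind_godel \<phi>) \<le> lind_godel \<psi>"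
  using le_lind_godel_imp[of "lind_godel (IImp \<phi> \<psi>)" \<phi> \<psi>] by (simp add: lind_godel_open)

lemma lind_godel_IPC: "\<phi> \<in> IPC \<Longrightarrow> lind_godel \<phi> = top"
proof (induction rule: IPC.induct)
  case (imp_S \<phi> \<psi> \<chi>)
  let ?X = "lind_godel (IImp \<phi> (IImp \<psi> \<chi>))" and ?Y = "lind_godel (IImp \<phi> \<psi>)"
  have "inf (inf ?X ?Y) (lind_godel \<phi>) \<le> inf (inf ?X (lind_godel \<phi>)) (inf ?Y (lind_godel \<phi>))"
    by (simp add: le_infI1)
  also have "\<dots> \<le> inf (lind_godel (IImp \<psi> \<chi>)) (lind_godel \<psi>)"
    by (intro inf_mono lind_godel_mp)
  also have "\<dots> \<le> lind_godel \<chi>" by (rule lind_godel_mp)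
  finally show ?case
    by (simp add: lind_godel_imp_top le_lind_godel_imp lind_godel_open lind.I_inf)
next
  case (or_E \<phi> \<chi> \<psi>)
  let ?X = "lind_godel (IImp \<phi> \<chi>)" and ?Y = "lind_godel (IImp \<psi> \<chi>)"
  have "inf (inf ?X ?Y) (lind_godel \<phi>) \<le> lind_godel \<chi>"
    by (rule order_trans[OF _ lind_godel_mp[of \<phi>]]) (simp add: le_infI1)
  moreover have "inf (inf ?X ?Y) (lind_godel \<psi>) \<le> lind_godel \<chi>"
    by (rule order_trans[OF _ lind_godel_mp[of \<psi>]]) (simp add: le_infI1)
  ultimately have "inf (inf ?X ?Y) (lind_godel (IOr \<phi> \<psi>)) \<le> lind_godel \<chi>"
    by (simp add: lind_godel_simps(5) inf_sup_distrib1)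
  then show ?case
    by (simp add: lind_godel_imp_top le_lind_godel_imp lind_godel_open lind.I_inf)
next
  case (mp \<phi> \<psi>)
  then show ?case using lind_godel_mp[of \<phi> \<psi>] by (simp add: top_unique)
qed (simp_all add: lind_godel_imp_top le_lind_godel_imp lind_godel_open lind_godel_simps(2-5))

text \<open>The values of translations form a Heyting subalgebra of the open elements closed under the
  second modality, so the Boolean subalgebra generated by them is closed under both
  modalities: the interior of a Boolean combination of translations is the translation of a conjunction of
  implications, and \<open>M a = M (I a)\<close>.\<close>

definition godel_classes :: "lind set" where
  "godel_classes = range lind_godel"

lemma bounded_sublattice_godel: "bounded_sublattice godel_classes"
proof -
  have "top \<in> godel_classes" "bot \<in> godel_classes"
    unfolding godel_classes_def by (metis lind_godel_simps(2) rangeI, metis lind_godel_simps(3) rangeI)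
  moreover have "inf a b \<in> godel_classes \<and> sup a b \<in> godel_classes"
    if "a \<in> godel_classes" "b \<in> godel_classes" for a b
    using that unfolding godel_classes_def by (auto simp flip: lind_godel_simps(4,5))
  ultimately show ?thesis by (simp add: bounded_sublattice_def)
qed

lemma lind_I_clausal_godel:
  assumes "a \<in> clausal godel_classes"
  shows "lind_I a \<in> godel_classes"
proof (rule lind.I_clausal[OF _ _ _ _ assms])
  show "lind_I a = a" if "a \<in> godel_classes" for a
    using that by (auto simp: godel_classes_def lind_godel_open)
  show "top \<in> godel_classes" "\<And>a b. a \<in> godel_classes \<Longrightarrow> b \<in> godel_classes \<Longrightarrow> inf a b \<in> godel_classes"
    using bounded_sublattice_godel by (simp_all add: bounded_sublattice_def)
  show "lind_I (sup (- a) b) \<in> godel_classes" if "a \<in> godel_classes" "b \<in> godel_classes" for a b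
    using that unfolding godel_classes_def by (auto simp flip: lind_godel_simps(6))
qed

lemma lind_M_clausal_godel:
  assumes "a \<in> clausal godel_classes"
  shows "lind_M a \<in> godel_classes"
proof -
  obtain \<chi> where "lind_I a = lind_godel \<chi>"
    using lind_I_clausal_godel[OF assms] by (auto simp: godel_classes_def)
  then have "lind_M a = lind_godel (IBox \<chi>)"
    using lind.M_I[of a] by (simp add: lind_godel_simps(7))
  then show ?thesis by (simp add: godel_classes_def)
qed

lemma lind_eval_clausal_godel:
  assumes "\<And>p. v p \<in> clausal godel_classes"
  shows "lind_eval v \<phi> \<in> clausal godel_classes"
proof -
  note H = bounded_sublattice_godel
  show ?thesis
    by (induction \<phi>) (auto simp: assms clausal.top clausal_bot[OF H]
      intro: clausal_inf clausal_sup[OF H] clausal_uminus[OF H] subset_clausal[OF H]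
        lind_I_clausal_godel lind_M_clausal_godel)
qed


section \<open>Reducing bimodal formulas to Goedel translations\<close>

instance bfm :: countable
  by countable_datatype

text \<open>A Boolean combination of open elements is the value of a Boolean combination of formulas
  \<open>BoxI (BVar i)\<close>, the translations of variables. Using one valuation \<open>e\<close> that
  exhausts the algebra makes it unnecessary to choose fresh variables for different elements.\<close>

lemma open_generated_as_value:
  assumes "surj e" and "a \<in> clausal (range lind_I)"
  shows "\<exists>\<chi>. lind_eval e \<chi> = a \<and> abs_lind \<chi> \<in> clausal godel_classes"
  using assms(2)
proof induction
  case top
  show ?case
    by (rule exI[of _ BTop]) (simp flip: top_lind.abs_eq add: clausal.top)
next
  case (clause a b c)
  then obtain \<chi> where \<chi>: "lind_eval e \<chi> = c" "abs_lind \<chi> \<in> clausal godel_classes" by blast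
  obtain a' b' where "a = lind_I a'" "b = lind_I b'" using clause by blast
  moreover obtain i j where "a' = e i" "b' = e j" using \<open>surj e\<close> by (meson surj_def)
  ultimately have "a = lind_I (e i)" "b = lind_I (e j)" by simp_all
  moreover have "lind_I (abs_lind (BVar k)) \<in> godel_classes" for k
    by (simp add: godel_classes_def flip: lind_godel_simps(1))
  ultimately show ?case using \<chi>
    by (intro exI[of _ "BAnd (BImp (BoxI (BVar i)) (BoxI (BVar j))) \<chi>"])
      (simp flip: abs_lind_simps add: clausal.clause)
qed

text \<open>Sets of formulas that are closed under modus ponens and necessitation and contain the
  logic contain a formula if and only if they contain its box, so only interiors matter for
  membership.\<close>

definition interior_equiv :: "bfm \<Rightarrow> bfm \<Rightarrow> bool" where
  "interior_equiv \<phi> \<psi> \<longleftrightarrow> lind_I (abs_lind \<phi>) = lind_I (abs_lind \<psi>)"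

text \<open>The open-generated values of the variables are factored through the valuation by all formulas:
  \<open>s1\<close> replaces each variable by a Boolean combination of formulas \<open>BoxI (BVar i)\<close>, and \<open>s2\<close>
  sends the variables of the latter to the formulas that they stand for.\<close>

theorem reduction_to_godel:
  assumes "finite \<Theta>"
  shows "\<exists>s1 s2 f. (\<forall>\<phi>. interior_equiv (bsubst s1 \<phi>) (godel (f \<phi>))) \<and>
    (\<forall>\<phi>\<in>\<Theta>. interior_equiv (bsubst s2 (bsubst s1 \<phi>)) \<phi>)"
proof -
  let ?v = "\<lambda>p. abs_lind (BVar p)"
  obtain w where w: "\<And>p. w p \<in> clausal (range lind_I)"
      "\<And>\<phi>. \<phi> \<in> \<Theta> \<Longrightarrow> lind_I (lind_eval w \<phi>) = lind_I (lind_eval ?v \<phi>)"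
    using lind.open_generated_valuation[OF assms, of ?v] by blast
  let ?s2 = "from_nat :: nat \<Rightarrow> bfm"
  let ?e = "\<lambda>q. abs_lind (?s2 q)"
  have "surj ?e"
  proof (rule surjI)
    fix a show "?e (to_nat (rep_lind a)) = a" by (simp add: Quotient3_abs_rep[OF Quotient3_lind])
  qed
  then have "\<forall>p. \<exists>\<chi>. lind_eval ?e \<chi> = w p \<and> abs_lind \<chi> \<in> clausal godel_classes"
    using open_generated_as_value w(1) by blast
  from choice[OF this] obtain s1 where s1:
    "\<And>p. lind_eval ?e (s1 p) = w p" "\<And>p. abs_lind (s1 p) \<in> clausal godel_classes"
    by blast
  have "\<exists>\<psi>. lind_I (abs_lind (bsubst s1 \<phi>)) = lind_godel \<psi>" for \<phi>
  proof -
    have "abs_lind (bsubst s1 \<phi>) \<in> clausal godel_classes"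
      unfolding abs_lind_bsubst using s1(2) by (rule lind_eval_clausal_godel)
    from lind_I_clausal_godel[OF this] show ?thesis
      by (auto simp: godel_classes_def)
  qed
  then obtain f where f: "\<And>\<phi>. lind_I (abs_lind (bsubst s1 \<phi>)) = lind_godel (f \<phi>)" by metis
  show ?thesis
  proof (intro exI conjI allI ballI)
    show "interior_equiv (bsubst s1 \<phi>) (godel (f \<phi>))" for \<phi>
      using f lind_godel_open[of "f \<phi>"] by (simp add: interior_equiv_def lind_godel_def)
    show "interior_equiv (bsubst ?s2 (bsubst s1 \<phi>)) \<phi>" if "\<phi> \<in> \<Theta>" for \<phi>
    proof -
      have "abs_lind (bsubst ?s2 (bsubst s1 \<phi>)) = lind_eval w \<phi>"
        by (simp add: abs_lind_bsubst[of ?s2] alg_eval_bsubst s1(1))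
      moreover have "lind_eval ?v \<phi> = abs_lind \<phi>"
        using abs_lind_bsubst[of BVar \<phi>] by (simp add: bsubst_BVar)
      ultimately show ?thesis
        using w(2)[OF that] by (simp add: interior_equiv_def)
    qed
  qed
qed


section \<open>Multi-conclusion consequence relations\<close>

text \<open>A set is saturated if, as a two-valued valuation, it satisfies all rules of \<open>S\<close>.\<close>

definition saturated :: "'f mrule set \<Rightarrow> 'f set \<Rightarrow> bool" where
  "saturated S T \<longleftrightarrow> (\<forall>\<Gamma> \<Delta>. (\<Gamma>, \<Delta>) \<in> S \<longrightarrow> fset \<Gamma> \<subseteq> T \<longrightarrow> (\<exists>\<delta>. \<delta> |\<in>| \<Delta> \<and> \<delta> \<in> T))"

lemma saturatedD:
  "saturated S T \<Longrightarrow> (\<Gamma>, \<Delta>) \<in> S \<Longrightarrow> fset \<Gamma> \<subseteq> T \<Longrightarrow> \<exists>\<delta>. \<delta> |\<in>| \<Delta> \<and> \<delta> \<in> T"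
  by (simp add: saturated_def)

lemma mc_conseqD:
  assumes "mc_conseq sub S"
  shows mc_conseq_subst: "r \<in> S \<Longrightarrow> map_rule (sub s) r \<in> S"
    and mc_conseq_refl: "({|\<phi>|}, {|\<phi>|}) \<in> S"
    and mc_conseq_weaken: "(\<Gamma>, \<Delta>) \<in> S \<Longrightarrow> (\<Gamma> |\<union>| \<Gamma>', \<Delta> |\<union>| \<Delta>') \<in> S"
    and mc_conseq_cut: "(\<Gamma>, \<Delta> |\<union>| {|\<phi>|}) \<in> S \<Longrightarrow> (\<Gamma> |\<union>| {|\<phi>|}, \<Delta>) \<in> S \<Longrightarrow> (\<Gamma>, \<Delta>) \<in> S"
  using assms unfolding mc_conseq_def by blast+

lemma mc_conseqI:
  assumes "\<And>s \<Gamma> \<Delta>. (\<Gamma>, \<Delta>) \<in> S \<Longrightarrow> (sub s |`| \<Gamma>, sub s |`| \<Delta>) \<in> S"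
    and "\<And>\<phi>. ({|\<phi>|}, {|\<phi>|}) \<in> S"
    and "\<And>\<Gamma> \<Delta> \<Gamma>' \<Delta>'. (\<Gamma>, \<Delta>) \<in> S \<Longrightarrow> (\<Gamma> |\<union>| \<Gamma>', \<Delta> |\<union>| \<Delta>') \<in> S"
    and "\<And>\<Gamma> \<Delta> \<phi>. (\<Gamma>, \<Delta> |\<union>| {|\<phi>|}) \<in> S \<Longrightarrow> (\<Gamma> |\<union>| {|\<phi>|}, \<Delta>) \<in> S \<Longrightarrow> (\<Gamma>, \<Delta>) \<in> S"
  shows "mc_conseq sub S"
  unfolding mc_conseq_def
proof (intro conjI allI ballI impI)
  show "map_rule (sub s) r \<in> S" if "r \<in> S" for s r
    using assms(1)[of "fst r" "snd r" s] that by (cases r) simp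
qed (use assms(2-4) in blast)+

lemma mc_conseq_subset_weaken:
  assumes "mc_conseq sub S" "(\<Gamma>, \<Delta>) \<in> S" "\<Gamma> |\<subseteq>| \<Gamma>'" "\<Delta> |\<subseteq>| \<Delta>'"
  shows "(\<Gamma>', \<Delta>') \<in> S"
  using mc_conseq_weaken[OF assms(1,2), of \<Gamma>' \<Delta>'] assms(3,4) by (simp add: sup_absorb2)

text \<open>A set that is maximal among those from which \<open>\<Delta>\<close> is not derivable is saturated: every
  formula outside it derives \<open>\<Delta>\<close> together with members, so a violated rule would yield a
  derivation of \<open>\<Delta>\<close> by cutting away its conclusions one by one.\<close>

lemma saturated_extension:
  assumes S: "mc_conseq sub S" and "(\<Gamma>, \<Delta>) \<notin> S"
  shows "\<exists>T. saturated S T \<and> fset \<Gamma> \<subseteq> T \<and> (\<forall>\<delta>. \<delta> |\<in>| \<Delta> \<longrightarrow> \<delta> \<notin> T)"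
proof -
  define \<A> where "\<A> = {T. fset \<Gamma> \<subseteq> T \<and> (\<forall>\<Gamma>'. fset \<Gamma>' \<subseteq> T \<longrightarrow> (\<Gamma>', \<Delta>) \<notin> S)}"
  have "\<exists>T\<in>\<A>. \<forall>U\<in>\<A>. T \<subseteq> U \<longrightarrow> U = T"
  proof (rule subset_Zorn_nonempty)
    have "(\<Gamma>', \<Delta>) \<notin> S" if "fset \<Gamma>' \<subseteq> fset \<Gamma>" for \<Gamma>'
      using mc_conseq_subset_weaken[OF S _ _ order_refl] that assms(2) by (metis less_eq_fset.rep_eq)
    then have "fset \<Gamma> \<in> \<A>" by (simp add: \<A>_def)
    then show "\<A> \<noteq> {}" by blast
    show "\<Union>\<C> \<in> \<A>" if "\<C> \<noteq> {}" "subset.chain \<A> \<C>" for \<C>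
    proof -
      have C: "\<C> \<subseteq> \<A>" using that(2) by (simp add: subset.chain_def)
      then have "fset \<Gamma> \<subseteq> \<Union>\<C>" using that(1) by (auto simp: \<A>_def)
      moreover have "(\<Gamma>', \<Delta>) \<notin> S" if sub: "fset \<Gamma>' \<subseteq> \<Union>\<C>" for \<Gamma>'
      proof -
        obtain B where "B \<in> \<C>" "fset \<Gamma>' \<subseteq> B"
          using finite_subset_Union_chain[OF finite_fset sub \<open>\<C> \<noteq> {}\<close> \<open>subset.chain \<A> \<C>\<close>] by blast
        then show ?thesis using C by (auto simp: \<A>_def)
      qed
      ultimately show ?thesis by (simp add: \<A>_def)
    qed
  qed
  then obtain T where T: "T \<in> \<A>" and max: "\<And>U. U \<in> \<A> \<Longrightarrow> T \<subseteq> U \<Longrightarrow> U = T" by blast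
  have consistent: "(\<Gamma>', \<Delta>) \<notin> S" if "fset \<Gamma>' \<subseteq> T" for \<Gamma>'
    using T that by (simp add: \<A>_def)
  have outside: "\<exists>\<Gamma>'. fset \<Gamma>' \<subseteq> T \<and> (\<Gamma>' |\<union>| {|\<psi>|}, \<Delta>) \<in> S" if "\<psi> \<notin> T" for \<psi>
  proof -
    have "insert \<psi> T \<notin> \<A>" using max[of "insert \<psi> T"] that by blast
    then obtain \<Gamma>' where G: "fset \<Gamma>' \<subseteq> insert \<psi> T" "(\<Gamma>', \<Delta>) \<in> S" using T by (auto simp: \<A>_def)
    have "((\<Gamma>' |-| {|\<psi>|}) |\<union>| {|\<psi>|}, \<Delta>) \<in> S"
      by (rule mc_conseq_subset_weaken[OF S G(2)]) auto
    moreover have "fset (\<Gamma>' |-| {|\<psi>|}) \<subseteq> T" using G(1) by auto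
    ultimately show ?thesis by blast
  qed
  have no_cut: "\<exists>\<delta>. \<delta> |\<in>| \<Delta>' \<and> \<delta> \<in> T" if "(\<Gamma>', \<Delta>' |\<union>| \<Delta>) \<in> S" "fset \<Gamma>' \<subseteq> T" for \<Gamma>' \<Delta>'
    using that
  proof (induction \<Delta>' arbitrary: \<Gamma>')
    case empty
    then show ?case using consistent by auto
  next
    case (insert \<psi> \<Delta>')
    show ?case
    proof (cases "\<psi> \<in> T")
      case True
      then show ?thesis by blast
    next
      case False
      then obtain \<Gamma>'' where G: "fset \<Gamma>'' \<subseteq> T" "(\<Gamma>'' |\<union>| {|\<psi>|}, \<Delta>) \<in> S" using outside by blast
      have "((\<Gamma>' |\<union>| \<Gamma>''), (\<Delta>' |\<union>| \<Delta>) |\<union>| {|\<psi>|}) \<in> S"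
        by (rule mc_conseq_subset_weaken[OF S insert.prems(1)]) auto
      moreover have "((\<Gamma>' |\<union>| \<Gamma>'') |\<union>| {|\<psi>|}, \<Delta>' |\<union>| \<Delta>) \<in> S"
        by (rule mc_conseq_subset_weaken[OF S G(2)]) auto
      ultimately have "(\<Gamma>' |\<union>| \<Gamma>'', \<Delta>' |\<union>| \<Delta>) \<in> S" by (rule mc_conseq_cut[OF S])
      then have "\<exists>\<delta>. \<delta> |\<in>| \<Delta>' \<and> \<delta> \<in> T"
        by (rule insert.IH) (use insert.prems(2) G(1) in auto)
      then show ?thesis by blast
    qed
  qed
  show ?thesis
  proof (intro exI conjI allI impI)
    show "fset \<Gamma> \<subseteq> T" using T by (simp add: \<A>_def)
    show "saturated S T"
      unfolding saturated_def using no_cut mc_conseq_subset_weaken[OF S] by (meson order_refl sup_ge1)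
    show "\<delta> \<notin> T" if "\<delta> |\<in>| \<Delta>" for \<delta>
    proof
      assume "\<delta> \<in> T"
      moreover have "({|\<delta>|}, \<Delta>) \<in> S"
        by (rule mc_conseq_subset_weaken[OF S mc_conseq_refl[OF S]]) (use that in auto)
      ultimately show False using consistent[of "{|\<delta>|}"] by simp
    qed
  qed
qed

lemma mc_conseq_if_saturated:
  assumes "mc_conseq sub S"
    and "\<And>T. saturated S T \<Longrightarrow> fset \<Gamma> \<subseteq> T \<Longrightarrow> \<exists>\<delta>. \<delta> |\<in>| \<Delta> \<and> \<delta> \<in> T"
  shows "(\<Gamma>, \<Delta>) \<in> S"
  using saturated_extension[OF assms(1), of \<Gamma> \<Delta>] assms(2) by blast

lemma mc_conseq_Inter:
  assumes "\<And>S. S \<in> \<S> \<Longrightarrow> mc_conseq sub S"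
  shows "mc_conseq sub (\<Inter>\<S>)"
proof (rule mc_conseqI)
  show "(sub s |`| \<Gamma>, sub s |`| \<Delta>) \<in> \<Inter>\<S>" if "(\<Gamma>, \<Delta>) \<in> \<Inter>\<S>" for s \<Gamma> \<Delta>
    using mc_conseq_subst[OF assms, of _ "(\<Gamma>, \<Delta>)" s] that by auto
  show "({|\<phi>|}, {|\<phi>|}) \<in> \<Inter>\<S>" for \<phi>
    using mc_conseq_refl[OF assms] by auto
  show "(\<Gamma> |\<union>| \<Gamma>', \<Delta> |\<union>| \<Delta>') \<in> \<Inter>\<S>" if "(\<Gamma>, \<Delta>) \<in> \<Inter>\<S>" for \<Gamma> \<Gamma>' \<Delta> \<Delta>'
    using mc_conseq_weaken[OF assms] that by auto
  show "(\<Gamma>, \<Delta>) \<in> \<Inter>\<S>" if "(\<Gamma>, \<Delta> |\<union>| {|\<phi>|}) \<in> \<Inter>\<S>" "(\<Gamma> |\<union>| {|\<phi>|}, \<Delta>) \<in> \<Inter>\<S>" for \<Gamma> \<Delta> \<phi>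
    using mc_conseq_cut[OF assms, of _ \<Gamma> \<Delta> \<phi>] that by auto
qed

lemma bim_conseq_Inter: "(\<And>S. S \<in> \<S> \<Longrightarrow> bim_conseq S) \<Longrightarrow> bim_conseq (\<Inter>\<S>)"
  unfolding bim_conseq_def by (simp add: mc_conseq_Inter)

lemma int_conseq_Inter: "(\<And>S. S \<in> \<S> \<Longrightarrow> int_conseq S) \<Longrightarrow> int_conseq (\<Inter>\<S>)"
  unfolding int_conseq_def by (simp add: mc_conseq_Inter)

lemma saturated_axiom: "saturated S T \<Longrightarrow> axiom_rule \<phi> \<in> S \<Longrightarrow> \<phi> \<in> T"
  using saturatedD[of S T "{||}" "{|\<phi>|}"] by simp

lemma saturated_bim_conseq:
  assumes "bim_conseq S" "saturated S T"
  shows saturated_bim_mp: "BImp \<phi> \<psi> \<in> T \<Longrightarrow> \<phi> \<in> T \<Longrightarrow> \<psi> \<in> T"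
    and saturated_bim_I: "\<phi> \<in> T \<Longrightarrow> BoxI \<phi> \<in> T"
    and saturated_bim_M: "\<phi> \<in> T \<Longrightarrow> BoxM \<phi> \<in> T"
  using assms(1) saturatedD[OF assms(2), of "{|BImp \<phi> \<psi>, \<phi>|}" "{|\<psi>|}"]
    saturatedD[OF assms(2), of "{|\<phi>|}" "{|BoxI \<phi>|}"]
    saturatedD[OF assms(2), of "{|\<phi>|}" "{|BoxM \<phi>|}"]
  unfolding bim_conseq_def by auto

lemma saturated_int_conseq:
  assumes "int_conseq S" "saturated S T"
  shows saturated_int_IntK: "IntK \<subseteq> T"
    and saturated_int_mp: "IImp \<phi> \<psi> \<in> T \<Longrightarrow> \<phi> \<in> T \<Longrightarrow> \<psi> \<in> T"
    and saturated_int_nec: "\<phi> \<in> T \<Longrightarrow> IBox \<phi> \<in> T"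
  using assms(1) saturatedD[OF assms(2), of "{|IImp \<phi> \<psi>, \<phi>|}" "{|\<psi>|}"]
    saturatedD[OF assms(2), of "{|\<phi>|}" "{|IBox \<phi>|}"] saturated_axiom[OF assms(2)]
  unfolding int_conseq_def by auto


section \<open>Lattice isomorphisms from monotone inverses\<close>

text \<open>Joins and meets are determined by the order, so mutually inverse monotone maps preserve them.\<close>

lemma lattice_iso_if_inverse:
  assumes P: "\<And>\<X>. (\<And>X. X \<in> \<X> \<Longrightarrow> P X) \<Longrightarrow> P (\<Inter>\<X>)"
    and Q: "\<And>\<Y>. (\<And>Y. Y \<in> \<Y> \<Longrightarrow> Q Y) \<Longrightarrow> Q (\<Inter>\<Y>)"
    and f: "\<And>X. X \<in> NExt P L \<Longrightarrow> f X \<in> NExt Q M"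
    and g: "\<And>Y. Y \<in> NExt Q M \<Longrightarrow> g Y \<in> NExt P L"
    and mono_f: "\<And>X X'. X \<in> NExt P L \<Longrightarrow> X' \<in> NExt P L \<Longrightarrow> X \<subseteq> X' \<Longrightarrow> f X \<subseteq> f X'"
    and mono_g: "\<And>Y Y'. Y \<in> NExt Q M \<Longrightarrow> Y' \<in> NExt Q M \<Longrightarrow> Y \<subseteq> Y' \<Longrightarrow> g Y \<subseteq> g Y'"
    and gf: "\<And>X. X \<in> NExt P L \<Longrightarrow> g (f X) = X"
    and fg: "\<And>Y. Y \<in> NExt Q M \<Longrightarrow> f (g Y) = Y"
  shows "lattice_iso P L Q M f"
proof -
  have inter: "X \<inter> X' \<in> NExt R K"
    if "\<And>\<X>. (\<And>X. X \<in> \<X> \<Longrightarrow> R X) \<Longrightarrow> R (\<Inter>\<X>)" "X \<in> NExt R K" "X' \<in> NExt R K"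
    for R :: "'x set \<Rightarrow> bool" and K X X'
    using that(1)[of "{X, X'}"] that(2,3) by (auto simp: NExt_def)
  have join: "oplus R X X' \<in> NExt R K"
    if "\<And>\<X>. (\<And>X. X \<in> \<X> \<Longrightarrow> R X) \<Longrightarrow> R (\<Inter>\<X>)" "X \<in> NExt R K"
    for R :: "'x set \<Rightarrow> bool" and K X X'
  proof -
    have "R (oplus R X X')" unfolding oplus_def by (rule hull_in) (simp add: that(1))
    moreover have "X \<subseteq> oplus R X X'" unfolding oplus_def by (meson hull_subset le_sup_iff)
    ultimately show ?thesis using that(2) by (auto simp: NExt_def)
  qed
  have upper: "X \<subseteq> oplus R X X'" "X' \<subseteq> oplus R X X'" for R :: "'x set \<Rightarrow> bool" and X X'
    unfolding oplus_def by (meson hull_subset le_sup_iff)+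
  have least: "oplus R X X' \<subseteq> Z" if "X \<subseteq> Z" "X' \<subseteq> Z" "Z \<in> NExt R K"
    for R :: "'x set \<Rightarrow> bool" and K X X' Z
    unfolding oplus_def by (rule hull_minimal) (use that in \<open>auto simp: NExt_def\<close>)
  have "f (oplus P X Y) = oplus Q (f X) (f Y) \<and> f (X \<inter> Y) = f X \<inter> f Y"
    if X: "X \<in> NExt P L" and Y: "Y \<in> NExt P L" for X Y
  proof (intro conjI antisym)
    note XY = join[OF P X, of Y] inter[OF P X Y]
    note fXY = join[OF Q f[OF X], of "f Y"] inter[OF Q f[OF X] f[OF Y]]
    have "X \<subseteq> g (oplus Q (f X) (f Y))" "Y \<subseteq> g (oplus Q (f X) (f Y))"
      using mono_g[OF f[OF X] fXY(1) upper(1)] mono_g[OF f[OF Y] fXY(1) upper(2)] gf X Y by auto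
    then have "oplus P X Y \<subseteq> g (oplus Q (f X) (f Y))" using g[OF fXY(1)] by (rule least)
    then show "f (oplus P X Y) \<subseteq> oplus Q (f X) (f Y)"
      using mono_f[OF XY(1) g[OF fXY(1)]] fg[OF fXY(1)] by simp
    show "oplus Q (f X) (f Y) \<subseteq> f (oplus P X Y)"
      by (rule least[OF mono_f[OF X XY(1) upper(1)] mono_f[OF Y XY(1) upper(2)] f[OF XY(1)]])
    show "f (X \<inter> Y) \<subseteq> f X \<inter> f Y"
      using mono_f[OF XY(2) X Int_lower1] mono_f[OF XY(2) Y Int_lower2] by (rule Int_greatest)
    have "g (f X \<inter> f Y) \<subseteq> X \<inter> Y"
      using mono_g[OF fXY(2) f[OF X] Int_lower1] mono_g[OF fXY(2) f[OF Y] Int_lower2] gf X Y by auto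
    then show "f X \<inter> f Y \<subseteq> f (X \<inter> Y)"
      using mono_f[OF g[OF fXY(2)] XY(2)] fg[OF fXY(2)] by simp
  qed
  moreover have "bij_betw f (NExt P L) (NExt Q M)"
    by (rule bij_betw_byWitness[where f' = g]) (use f g gf fg in auto)
  ultimately show ?thesis by (simp add: lattice_iso_def)
qed


section \<open>Frames of prime theories\<close>

definition prime_theories :: "ifm set \<Rightarrow> ifm set set" where
  "prime_theories T = {x. T \<subseteq> x \<and> (\<forall>\<phi> \<psi>. IImp \<phi> \<psi> \<in> x \<longrightarrow> \<phi> \<in> x \<longrightarrow> \<psi> \<in> x) \<and>
     IBot \<notin> x \<and> (\<forall>\<phi> \<psi>. IOr \<phi> \<psi> \<in> x \<longrightarrow> \<phi> \<in> x \<or> \<psi> \<in> x)}"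

definition box_related :: "ifm set \<Rightarrow> ifm set \<Rightarrow> bool" where
  "box_related x y \<longleftrightarrow> (\<forall>\<phi>. IBox \<phi> \<in> x \<longrightarrow> \<phi> \<in> y)"

lemma box_related_mono: "box_related x y \<Longrightarrow> y \<subseteq> z \<Longrightarrow> box_related x z"
  by (auto simp: box_related_def)

text \<open>Truth sets in the Kripke frame whose worlds are in \<open>X\<close>, with inclusion as the accessibility
  relation for \<open>BoxI\<close> and \<open>box_related\<close> for \<open>BoxM\<close>.\<close>

primrec extent :: "ifm set set \<Rightarrow> (nat \<Rightarrow> ifm set set) \<Rightarrow> bfm \<Rightarrow> ifm set set" where
  "extent X V (BVar p) = V p \<inter> X"
| "extent X V BTop = X"
| "extent X V BBot = {}"
| "extent X V (BNot \<phi>) = X - extent X V \<phi>"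
| "extent X V (BAnd \<phi> \<psi>) = extent X V \<phi> \<inter> extent X V \<psi>"
| "extent X V (BOr \<phi> \<psi>) = extent X V \<phi> \<union> extent X V \<psi>"
| "extent X V (BoxI \<phi>) = {x \<in> X. \<forall>y\<in>X. x \<subseteq> y \<longrightarrow> y \<in> extent X V \<phi>}"
| "extent X V (BoxM \<phi>) = {x \<in> X. \<forall>y\<in>X. box_related x y \<longrightarrow> y \<in> extent X V \<phi>}"

text \<open>For a set of prime theories these are the Boolean combinations of the sets of worlds that
  contain a given formula. In this form closure under Boolean operations and the finiteness
  behind the Grzegorczyk axiom are immediate.\<close>

definition finitely_determined :: "ifm set set \<Rightarrow> ifm set set \<Rightarrow> bool" where
  "finitely_determined X A \<longleftrightarrow>
     (\<exists>F. finite F \<and> (\<forall>x\<in>X. \<forall>y\<in>X. x \<inter> F = y \<inter> F \<longrightarrow> x \<in> A \<longrightarrow> y \<in> A))"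

definition admissible :: "ifm set set \<Rightarrow> (nat \<Rightarrow> ifm set set) \<Rightarrow> bool" where
  "admissible X V \<longleftrightarrow> (\<forall>p. finitely_determined X (V p))"

lemma extent_subset: "extent X V \<phi> \<subseteq> X"
  by (induction \<phi>) auto

lemma ceval_extent: "x \<in> X \<Longrightarrow> ceval (\<lambda>\<psi>. x \<in> extent X V \<psi>) \<phi> \<longleftrightarrow> x \<in> extent X V \<phi>"
  by (induction \<phi>) auto

lemma extent_bsubst: "extent X V (bsubst s \<phi>) = extent X (\<lambda>p. extent X V (s p)) \<phi>"
  by (induction \<phi>) (simp_all add: Int_absorb2 extent_subset)

lemma finitely_determined_theory: "finitely_determined X {x \<in> X. \<phi> \<in> x}"
  unfolding finitely_determined_def by (rule exI[of _ "{\<phi>}"]) auto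

lemma finitely_determined_self: "finitely_determined X X"
  unfolding finitely_determined_def by (rule exI[of _ "{}"]) simp

lemma finitely_determinedE:
  assumes "finitely_determined X A"
  obtains F where "finite F"
    and "\<And>x y. x \<in> X \<Longrightarrow> y \<in> X \<Longrightarrow> x \<inter> F = y \<inter> F \<Longrightarrow> x \<in> A \<Longrightarrow> y \<in> A"
proof -
  obtain F where F: "finite F" "\<forall>x\<in>X. \<forall>y\<in>X. x \<inter> F = y \<inter> F \<longrightarrow> x \<in> A \<longrightarrow> y \<in> A"
    using assms unfolding finitely_determined_def by blast
  show thesis by (rule that[OF F(1)]) (rule F(2)[rule_format])
qed

lemma finitely_determined_compl:
  assumes "finitely_determined X A"
  shows "finitely_determined X (X - A)"
proof -
  obtain F where "finite F" "\<forall>x\<in>X. \<forall>y\<in>X. x \<inter> F = y \<inter> F \<longrightarrow> x \<in> A \<longrightarrow> y \<in> A"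
    using assms unfolding finitely_determined_def by blast
  then show ?thesis
    unfolding finitely_determined_def by (intro exI[of _ F]) (metis DiffD2 DiffI)
qed

lemma finitely_determined_Int:
  assumes "finitely_determined X A" "finitely_determined X B"
  shows "finitely_determined X (A \<inter> B)"
proof -
  obtain F where F: "finite F" "\<And>x y. x \<in> X \<Longrightarrow> y \<in> X \<Longrightarrow> x \<inter> F = y \<inter> F \<Longrightarrow> x \<in> A \<Longrightarrow> y \<in> A"
    using assms(1) by (rule finitely_determinedE) (rule that)
  obtain G where G: "finite G" "\<And>x y. x \<in> X \<Longrightarrow> y \<in> X \<Longrightarrow> x \<inter> G = y \<inter> G \<Longrightarrow> x \<in> B \<Longrightarrow> y \<in> B"
    using assms(2) by (rule finitely_determinedE) (rule that)
  have "y \<in> A \<inter> B" if "x \<in> X" "y \<in> X" "x \<inter> (F \<union> G) = y \<inter> (F \<union> G)" "x \<in> A \<inter> B" for x y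
  proof -
    have eq: "x \<inter> F = y \<inter> F" "x \<inter> G = y \<inter> G" using that(3) by blast+
    have "y \<in> A" using F(2)[OF that(1,2) eq(1)] that(4) by simp
    moreover have "y \<in> B" using G(2)[OF that(1,2) eq(2)] that(4) by simp
    ultimately show ?thesis by (rule IntI)
  qed
  moreover have "finite (F \<union> G)" using F(1) G(1) by (rule finite_UnI)
  ultimately show ?thesis unfolding finitely_determined_def by blast
qed

text \<open>The common features of intuitionistic modal logics and of the saturated sets of consequence
  relations, each of which is the set of formulas that belong to all prime theories above it.\<close>

locale int_theory =
  fixes T :: "ifm set"
  assumes IntK_subset: "IntK \<subseteq> T"
    and mp: "IImp \<phi> \<psi> \<in> T \<Longrightarrow> \<phi> \<in> T \<Longrightarrow> \<psi> \<in> T"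
    and nec: "\<phi> \<in> T \<Longrightarrow> IBox \<phi> \<in> T"
begin

abbreviation X :: "ifm set set" where
  "X \<equiv> prime_theories T"

lemma IPC_subset: "\<phi> \<in> IPC \<Longrightarrow> \<phi> \<in> T"
  using int_logic_IPC[OF int_logic_IntK] IntK_subset by blast

definition deductive :: "ifm set \<Rightarrow> bool" where
  "deductive U \<longleftrightarrow> T \<subseteq> U \<and> (\<forall>\<phi> \<psi>. IImp \<phi> \<psi> \<in> U \<longrightarrow> \<phi> \<in> U \<longrightarrow> \<psi> \<in> U)"

lemma deductive_IPC: "deductive U \<Longrightarrow> \<phi> \<in> IPC \<Longrightarrow> \<phi> \<in> U"
  using IPC_subset by (auto simp: deductive_def)

lemma deductive_mp: "deductive U \<Longrightarrow> IImp \<phi> \<psi> \<in> U \<Longrightarrow> \<phi> \<in> U \<Longrightarrow> \<psi> \<in> U"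
  by (auto simp: deductive_def)

lemma deductive_T: "deductive T"
  using mp by (simp add: deductive_def)

lemma prime_deductive: "x \<in> X \<Longrightarrow> deductive x"
  by (simp add: prime_theories_def deductive_def)

lemma deductive_relative:
  assumes U: "deductive U"
  shows "deductive {\<psi>. IImp \<phi> \<psi> \<in> U}" "U \<subseteq> {\<psi>. IImp \<phi> \<psi> \<in> U}" "IImp \<phi> \<phi> \<in> U"
proof -
  show sub: "U \<subseteq> {\<psi>. IImp \<phi> \<psi> \<in> U}"
    using deductive_mp[OF U deductive_IPC[OF U IPC.imp_K]] by blast
  show "IImp \<phi> \<phi> \<in> U"
    using deductive_mp[OF U deductive_mp[OF U deductive_IPC[OF U IPC.imp_S]]]
      deductive_IPC[OF U IPC.imp_K] by blast
  have "IImp \<phi> \<chi> \<in> U" if "IImp \<phi> (IImp \<psi> \<chi>) \<in> U" "IImp \<phi> \<psi> \<in> U" for \<psi> \<chi>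
    using deductive_mp[OF U deductive_mp[OF U deductive_IPC[OF U IPC.imp_S]]] that by blast
  then show "deductive {\<psi>. IImp \<phi> \<psi> \<in> U}"
    using sub U unfolding deductive_def by blast
qed

text \<open>A deductively closed set maximal among those avoiding \<open>\<chi>\<close> is prime: a formula outside it
  implies \<open>\<chi>\<close> in it, so a disjunction of two such formulas does so as well.\<close>

lemma prime_extension:
  assumes U: "deductive U" and "\<chi> \<notin> U"
  shows "\<exists>x\<in>X. U \<subseteq> x \<and> \<chi> \<notin> x"
proof -
  define \<A> where "\<A> = {x. U \<subseteq> x \<and> deductive x \<and> \<chi> \<notin> x}"
  have "\<exists>x\<in>\<A>. \<forall>y\<in>\<A>. x \<subseteq> y \<longrightarrow> y = x"
  proof (rule subset_Zorn_nonempty)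
    show "\<A> \<noteq> {}" using assms by (auto simp: \<A>_def)
    show "\<Union>\<C> \<in> \<A>" if "\<C> \<noteq> {}" "subset.chain \<A> \<C>" for \<C>
    proof -
      have C: "\<And>x. x \<in> \<C> \<Longrightarrow> U \<subseteq> x \<and> deductive x \<and> \<chi> \<notin> x" "\<And>x y. x \<in> \<C> \<Longrightarrow> y \<in> \<C> \<Longrightarrow> x \<subseteq> y \<or> y \<subseteq> x"
        using that(2) by (auto simp: subset.chain_def \<A>_def)
      have "\<psi> \<in> \<Union>\<C>" if imp: "IImp \<phi> \<psi> \<in> \<Union>\<C>" "\<phi> \<in> \<Union>\<C>" for \<phi> \<psi>
      proof -
        obtain x y where xy: "x \<in> \<C>" "IImp \<phi> \<psi> \<in> x" "y \<in> \<C>" "\<phi> \<in> y" using imp by blast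
        with C(2)[of x y] have "IImp \<phi> \<psi> \<in> y \<or> \<phi> \<in> x" by blast
        then have "\<psi> \<in> x \<or> \<psi> \<in> y"
          using xy C(1)[of x] C(1)[of y] deductive_mp[of x \<phi> \<psi>] deductive_mp[of y \<phi> \<psi>] by blast
        then show ?thesis using xy by blast
      qed
      moreover have "U \<subseteq> \<Union>\<C>" using C(1) that(1) by blast
      moreover have "T \<subseteq> \<Union>\<C>" using \<open>U \<subseteq> \<Union>\<C>\<close> U by (auto simp: deductive_def)
      ultimately show ?thesis using C(1) by (auto simp: \<A>_def deductive_def)
    qed
  qed
  then obtain x where x: "U \<subseteq> x" "deductive x" "\<chi> \<notin> x" and max: "\<And>y. y \<in> \<A> \<Longrightarrow> x \<subseteq> y \<Longrightarrow> y = x"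
    by (auto simp: \<A>_def)
  have outside: "IImp \<phi> \<chi> \<in> x" if "\<phi> \<notin> x" for \<phi>
  proof (rule ccontr)
    assume "IImp \<phi> \<chi> \<notin> x"
    then have "{\<psi>. IImp \<phi> \<psi> \<in> x} \<in> \<A>"
      using deductive_relative[OF x(2), of \<phi>] x(1) by (auto simp: \<A>_def)
    then have "{\<psi>. IImp \<phi> \<psi> \<in> x} = x"
      using deductive_relative(2)[OF x(2)] by (rule max)
    then show False using deductive_relative(3)[OF x(2), of \<phi>] that by blast
  qed
  have "IBot \<notin> x" using deductive_mp[OF x(2) deductive_IPC[OF x(2) IPC.bot_E[of \<chi>]]] x(3) by blast
  moreover have "\<phi> \<in> x \<or> \<psi> \<in> x" if "IOr \<phi> \<psi> \<in> x" for \<phi> \<psi>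
  proof (rule ccontr)
    assume "\<not> (\<phi> \<in> x \<or> \<psi> \<in> x)"
    then have imp: "IImp \<phi> \<chi> \<in> x" "IImp \<psi> \<chi> \<in> x" using outside by blast+
    have "IImp (IImp \<phi> \<chi>) (IImp (IImp \<psi> \<chi>) (IImp (IOr \<phi> \<psi>) \<chi>)) \<in> x"
      by (rule deductive_IPC[OF x(2) IPC.or_E])
    then have "\<chi> \<in> x" using imp that deductive_mp[OF x(2)] by blast
    then show False using x(3) by blast
  qed
  ultimately have "x \<in> X" using x(2) by (auto simp: prime_theories_def deductive_def)
  then show ?thesis using x by blast
qed

lemma in_theory_iff: "\<phi> \<in> T \<longleftrightarrow> (\<forall>x\<in>X. \<phi> \<in> x)"
proof
  show "\<forall>x\<in>X. \<phi> \<in> x" if "\<phi> \<in> T" using that unfolding prime_theories_def by blast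
  show "\<phi> \<in> T" if "\<forall>x\<in>X. \<phi> \<in> x" using prime_extension[OF deductive_T, of \<phi>] that by blast
qed

lemma prime_top: "x \<in> X \<Longrightarrow> ITop \<in> x"
  using deductive_IPC[OF prime_deductive IPC.top_I] .

lemma prime_bot: "x \<in> X \<Longrightarrow> IBot \<notin> x"
  by (simp add: prime_theories_def)

lemma prime_and:
  assumes "x \<in> X"
  shows "IAnd \<phi> \<psi> \<in> x \<longleftrightarrow> \<phi> \<in> x \<and> \<psi> \<in> x"
proof -
  note x = prime_deductive[OF assms]
  note ax = IPC.and_E1[of \<phi> \<psi>] IPC.and_E2[of \<phi> \<psi>] IPC.and_I[of \<phi> \<psi>]
  show ?thesis using ax[THEN deductive_IPC[OF x]] deductive_mp[OF x] by blast
qed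

lemma prime_or:
  assumes "x \<in> X"
  shows "IOr \<phi> \<psi> \<in> x \<longleftrightarrow> \<phi> \<in> x \<or> \<psi> \<in> x"
proof -
  note x = prime_deductive[OF assms]
  note ax = IPC.or_I1[of \<phi> \<psi>] IPC.or_I2[of \<psi> \<phi>]
  have "IOr \<phi> \<psi> \<in> x \<Longrightarrow> \<phi> \<in> x \<or> \<psi> \<in> x" using assms by (simp add: prime_theories_def)
  then show ?thesis using ax[THEN deductive_IPC[OF x]] deductive_mp[OF x] by blast
qed

lemma prime_imp:
  assumes "x \<in> X"
  shows "IImp \<phi> \<psi> \<in> x \<longleftrightarrow> (\<forall>y\<in>X. x \<subseteq> y \<longrightarrow> \<phi> \<in> y \<longrightarrow> \<psi> \<in> y)"
proof
  show "\<forall>y\<in>X. x \<subseteq> y \<longrightarrow> \<phi> \<in> y \<longrightarrow> \<psi> \<in> y" if "IImp \<phi> \<psi> \<in> x"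
    using that deductive_mp[OF prime_deductive] by blast
  note rel = deductive_relative[OF prime_deductive[OF assms], of \<phi>]
  show "IImp \<phi> \<psi> \<in> x" if "\<forall>y\<in>X. x \<subseteq> y \<longrightarrow> \<phi> \<in> y \<longrightarrow> \<psi> \<in> y"
    using prime_extension[OF rel(1), of \<psi>] that rel(2,3) by blast
qed

lemma prime_box:
  assumes "x \<in> X"
  shows "IBox \<phi> \<in> x \<longleftrightarrow> (\<forall>y\<in>X. box_related x y \<longrightarrow> \<phi> \<in> y)"
proof
  show "\<forall>y\<in>X. box_related x y \<longrightarrow> \<phi> \<in> y" if "IBox \<phi> \<in> x"
    using that by (auto simp: box_related_def)
  note x = prime_deductive[OF assms]
  have "IBox \<chi> \<in> x" if "IBox (IImp \<psi> \<chi>) \<in> x" "IBox \<psi> \<in> x" for \<psi> \<chi>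
  proof -
    let ?and = "IAnd (IImp \<psi> \<chi>) \<psi>"
    have "IIff (IBox ?and) (IAnd (IBox (IImp \<psi> \<chi>)) (IBox \<psi>)) \<in> x"
      using int_logic_Box_and[OF int_logic_IntK] IntK_subset x unfolding deductive_def by blast
    then have and_box: "IBox ?and \<in> x"
      using that prime_and[OF assms] deductive_mp[OF x] by blast
    have "IImp ?and \<chi> \<in> IPC"
      by (rule IPC.mp[OF IPC.mp[OF IPC.imp_S IPC.and_E1] IPC.and_E2])
    then have "IImp (IBox ?and) (IBox \<chi>) \<in> IntK"
      using int_logic_IPC[OF int_logic_IntK] int_logic_Box_mono[OF int_logic_IntK] by blast
    then have "IImp (IBox ?and) (IBox \<chi>) \<in> x"
      using IntK_subset x unfolding deductive_def by blast
    then show ?thesis using and_box deductive_mp[OF x] by blast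
  qed
  moreover have "IBox \<psi> \<in> x" if "\<psi> \<in> T" for \<psi>
    using nec[OF that] x unfolding deductive_def by blast
  ultimately have "deductive {\<psi>. IBox \<psi> \<in> x}" unfolding deductive_def by blast
  from prime_extension[OF this, of \<phi>]
  show "IBox \<phi> \<in> x" if "\<forall>y\<in>X. box_related x y \<longrightarrow> \<phi> \<in> y"
    using that unfolding box_related_def by blast
qed

lemma finite_conjunction: "finite F \<Longrightarrow> \<exists>\<phi>. \<forall>x\<in>X. \<phi> \<in> x \<longleftrightarrow> F \<subseteq> x"
proof (induction F rule: finite_induct)
  case empty
  show ?case using prime_top by blast
next
  case (insert \<psi> F)
  then obtain \<phi> where "\<forall>x\<in>X. \<phi> \<in> x \<longleftrightarrow> F \<subseteq> x" by blast
  then show ?case by (intro exI[of _ "IAnd \<psi> \<phi>"]) (simp add: prime_and)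
qed

lemma finite_disjunction: "finite F \<Longrightarrow> \<exists>\<phi>. \<forall>x\<in>X. \<phi> \<in> x \<longleftrightarrow> F \<inter> x \<noteq> {}"
proof (induction F rule: finite_induct)
  case empty
  show ?case using prime_bot by blast
next
  case (insert \<psi> F)
  then obtain \<phi> where "\<forall>x\<in>X. \<phi> \<in> x \<longleftrightarrow> F \<inter> x \<noteq> {}" by blast
  then show ?case by (intro exI[of _ "IOr \<psi> \<phi>"]) (auto simp: prime_or)
qed

text \<open>The set \<open>A\<close> is the set of worlds whose trace on \<open>F\<close> is not bad, where a trace is bad if no
  world of \<open>A\<close> has it. Avoiding the trace \<open>G\<close> in all larger worlds is expressed by the
  implication from the conjunction of \<open>G\<close> to the disjunction of the remaining members of \<open>F\<close>.\<close>

lemma interior_representable: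
  assumes "finitely_determined X A"
  shows "\<exists>\<phi>. \<forall>x\<in>X. \<phi> \<in> x \<longleftrightarrow> (\<forall>y\<in>X. x \<subseteq> y \<longrightarrow> y \<in> A)"
proof -
  obtain F where F: "finite F" "\<And>x y. x \<in> X \<Longrightarrow> y \<in> X \<Longrightarrow> x \<inter> F = y \<inter> F \<Longrightarrow> x \<in> A \<Longrightarrow> y \<in> A"
    using assms by (rule finitely_determinedE) (rule that)
  have "\<forall>G\<in>Pow F. \<exists>\<phi>. \<forall>x\<in>X. \<phi> \<in> x \<longleftrightarrow> (\<forall>y\<in>X. x \<subseteq> y \<longrightarrow> y \<inter> F \<noteq> G)"
  proof
    fix G assume "G \<in> Pow F"
    then have "finite G" "finite (F - G)" using F(1) by (auto intro: finite_subset)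
    then obtain \<kappa> \<delta> where "\<forall>x\<in>X. \<kappa> \<in> x \<longleftrightarrow> G \<subseteq> x" "\<forall>x\<in>X. \<delta> \<in> x \<longleftrightarrow> (F - G) \<inter> x \<noteq> {}"
      using finite_conjunction finite_disjunction by meson
    moreover have "y \<inter> F \<noteq> G \<longleftrightarrow> (G \<subseteq> y \<longrightarrow> (F - G) \<inter> y \<noteq> {})" for y
      using \<open>G \<in> Pow F\<close> by blast
    ultimately show "\<exists>\<phi>. \<forall>x\<in>X. \<phi> \<in> x \<longleftrightarrow> (\<forall>y\<in>X. x \<subseteq> y \<longrightarrow> y \<inter> F \<noteq> G)"
      by (intro exI[of _ "IImp \<kappa> \<delta>"]) (simp add: prime_imp)
  qed
  from bchoice[OF this] obtain avoid where
    "\<forall>G\<in>Pow F. \<forall>x\<in>X. avoid G \<in> x \<longleftrightarrow> (\<forall>y\<in>X. x \<subseteq> y \<longrightarrow> y \<inter> F \<noteq> G)"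
    by (elim exE)
  then have avoid: "avoid G \<in> x \<longleftrightarrow> (\<forall>y\<in>X. x \<subseteq> y \<longrightarrow> y \<inter> F \<noteq> G)" if "G \<subseteq> F" "x \<in> X" for G x
    using that by simp
  define bad where "bad = {G \<in> Pow F. \<forall>y\<in>X. y \<inter> F = G \<longrightarrow> y \<notin> A}"
  have "finite (avoid ` bad)" using F(1) by (simp add: bad_def)
  from finite_conjunction[OF this] obtain \<phi> where \<phi>: "\<forall>x\<in>X. \<phi> \<in> x \<longleftrightarrow> avoid ` bad \<subseteq> x"
    by (elim exE)
  have "y \<in> A \<longleftrightarrow> y \<inter> F \<notin> bad" if y: "y \<in> X" for y
  proof
    show "y \<inter> F \<notin> bad" if "y \<in> A" using that y unfolding bad_def by blast
    show "y \<in> A" if not_bad: "y \<inter> F \<notin> bad"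
    proof -
      obtain z where "z \<in> X" "z \<inter> F = y \<inter> F" "z \<in> A"
        using not_bad unfolding bad_def by blast
      then show ?thesis using F(2)[of z y] y by simp
    qed
  qed
  moreover have "avoid ` bad \<subseteq> x \<longleftrightarrow> (\<forall>y\<in>X. x \<subseteq> y \<longrightarrow> y \<inter> F \<notin> bad)" if "x \<in> X" for x
  proof -
    have "avoid G \<in> x \<longleftrightarrow> (\<forall>y\<in>X. x \<subseteq> y \<longrightarrow> y \<inter> F \<noteq> G)" if "G \<in> bad" for G
      by (rule avoid) (use that \<open>x \<in> X\<close> in \<open>simp_all add: bad_def\<close>)
    then show ?thesis unfolding image_subset_iff by blast
  qed
  ultimately show ?thesis using \<phi> by (intro exI[of _ \<phi>]) simp
qed

lemma modal_representable:
  assumes \<phi>: "\<And>x. x \<in> X \<Longrightarrow> \<phi> \<in> x \<longleftrightarrow> (\<forall>y\<in>X. x \<subseteq> y \<longrightarrow> y \<in> A)" and "x \<in> X"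
  shows "IBox \<phi> \<in> x \<longleftrightarrow> (\<forall>y\<in>X. box_related x y \<longrightarrow> y \<in> A)"
proof -
  have "(\<forall>y\<in>X. box_related x y \<longrightarrow> \<phi> \<in> y) \<longleftrightarrow> (\<forall>y\<in>X. box_related x y \<longrightarrow> y \<in> A)"
  proof (intro iffI ballI impI)
    fix y assume y: "y \<in> X" "box_related x y"
    show "y \<in> A" if "\<forall>y\<in>X. box_related x y \<longrightarrow> \<phi> \<in> y"
      using \<phi>[OF y(1)] that y by blast
    show "\<phi> \<in> y" if A: "\<forall>y\<in>X. box_related x y \<longrightarrow> y \<in> A"
    proof (subst \<phi>[OF y(1)], intro ballI impI)
      fix z assume "z \<in> X" "y \<subseteq> z"
      then show "z \<in> A" using A box_related_mono[OF y(2)] by blast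
    qed
  qed
  then show ?thesis using prime_box[OF \<open>x \<in> X\<close>] by simp
qed

lemma extent_finitely_determined:
  assumes "admissible X V"
  shows "finitely_determined X (extent X V \<phi>)"
proof (induction \<phi>)
  case (BVar p)
  show ?case using assms by (simp add: admissible_def finitely_determined_Int finitely_determined_self)
next
  case (BOr \<phi> \<psi>)
  have "extent X V \<phi> \<union> extent X V \<psi> = X - ((X - extent X V \<phi>) \<inter> (X - extent X V \<psi>))"
    using extent_subset[of X V \<phi>] extent_subset[of X V \<psi>] by blast
  then show ?case
    using BOr by (simp only: extent.simps finitely_determined_compl finitely_determined_Int)
next
  case (BoxI \<phi>)
  obtain \<psi> where \<psi>: "\<forall>x\<in>X. \<psi> \<in> x \<longleftrightarrow> (\<forall>y\<in>X. x \<subseteq> y \<longrightarrow> y \<in> extent X V \<phi>)"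
    using interior_representable[OF BoxI] by (elim exE)
  have "extent X V (BoxI \<phi>) = {x \<in> X. \<psi> \<in> x}"
    unfolding extent.simps by (rule Collect_cong) (use \<psi> in meson)
  then show ?case by (simp only: finitely_determined_theory)
next
  case (BoxM \<phi>)
  obtain \<psi> where \<psi>: "\<forall>x\<in>X. \<psi> \<in> x \<longleftrightarrow> (\<forall>y\<in>X. x \<subseteq> y \<longrightarrow> y \<in> extent X V \<phi>)"
    using interior_representable[OF BoxM] by (elim exE)
  have "extent X V (BoxM \<phi>) = {x \<in> X. IBox \<psi> \<in> x}"
    unfolding extent.simps by (rule Collect_cong) (use modal_representable[OF \<psi>[rule_format]] in meson)
  then show ?case by (simp only: finitely_determined_theory)
next
  case BTop
  show ?case by (simp add: finitely_determined_self)
next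
  case BBot
  show ?case by (auto simp: finitely_determined_def)
qed (simp_all add: finitely_determined_compl finitely_determined_Int)

text \<open>Among the worlds above \<open>x\<close> outside \<open>A\<close> choose \<open>y\<close> with maximal trace on \<open>F\<close>. If \<open>A\<close> was
  entered above \<open>y\<close> and left again, the trace would be the same at all three worlds, so \<open>y\<close>
  would be in \<open>A\<close>. Hence the premise of the axiom applies to \<open>y\<close> and puts it into \<open>A\<close> after all.\<close>

lemma extent_Grz:
  assumes "finitely_determined X A" and "x \<in> X"
    and grz: "\<And>y. y \<in> X \<Longrightarrow> x \<subseteq> y \<Longrightarrow>
      (\<forall>z\<in>X. y \<subseteq> z \<longrightarrow> z \<in> A \<longrightarrow> (\<forall>w\<in>X. z \<subseteq> w \<longrightarrow> w \<in> A)) \<Longrightarrow> y \<in> A"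
  shows "x \<in> A"
proof (rule ccontr)
  assume "x \<notin> A"
  obtain F where F: "finite F" "\<And>x y. x \<in> X \<Longrightarrow> y \<in> X \<Longrightarrow> x \<inter> F = y \<inter> F \<Longrightarrow> x \<in> A \<Longrightarrow> y \<in> A"
    using assms(1) by (rule finitely_determinedE) (rule that)
  define \<T> where "\<T> = {y \<inter> F |y. y \<in> X \<and> x \<subseteq> y \<and> y \<notin> A}"
  have "\<T> \<subseteq> Pow F" by (auto simp: \<T>_def)
  then have "finite \<T>" using F(1) by (simp add: finite_subset)
  moreover have "x \<inter> F \<in> \<T>" using \<open>x \<in> X\<close> \<open>x \<notin> A\<close> by (auto simp: \<T>_def)
  ultimately obtain G where "G \<in> \<T>" and max: "\<And>G'. G' \<in> \<T> \<Longrightarrow> G \<subseteq> G' \<Longrightarrow> G' = G"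
    using finite_has_maximal[of \<T>] by blast
  then obtain y where y: "y \<in> X" "x \<subseteq> y" "y \<notin> A" "G = y \<inter> F" by (auto simp: \<T>_def)
  have "w \<in> A" if "z \<in> X" "y \<subseteq> z" "z \<in> A" "w \<in> X" "z \<subseteq> w" for z w
  proof (rule ccontr)
    assume "w \<notin> A"
    then have "w \<inter> F \<in> \<T>" using that y by (auto simp: \<T>_def)
    then have "w \<inter> F = y \<inter> F" using max[of "w \<inter> F"] that y by blast
    then have "z \<inter> F = y \<inter> F" using that by blast
    then show False using F(2)[of z y] that y by blast
  qed
  then show False using grz[OF y(1,2)] y(3) by blast
qed

text \<open>The accessibility relation absorbs inclusions on both sides.\<close>

lemma extent_Mix:
  assumes "x \<in> X"
  shows "(\<forall>y\<in>X. x \<subseteq> y \<longrightarrow> (\<forall>z\<in>X. box_related y z \<longrightarrow> (\<forall>w\<in>X. z \<subseteq> w \<longrightarrow> w \<in> A))) \<longleftrightarrow>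
    (\<forall>y\<in>X. box_related x y \<longrightarrow> y \<in> A)"
proof (intro iffI ballI impI)
  fix y assume y: "y \<in> X" "box_related x y"
  assume "\<forall>y\<in>X. x \<subseteq> y \<longrightarrow> (\<forall>z\<in>X. box_related y z \<longrightarrow> (\<forall>w\<in>X. z \<subseteq> w \<longrightarrow> w \<in> A))"
  from this[rule_format, OF assms order_refl y y(1) order_refl] show "y \<in> A" .
next
  fix y z w assume "\<forall>y\<in>X. box_related x y \<longrightarrow> y \<in> A" and "w \<in> X"
    and yzw: "x \<subseteq> y" "box_related y z" "z \<subseteq> w"
  moreover have "box_related x w" using yzw unfolding box_related_def by blast
  ultimately show "w \<in> A" by blast
qed

definition frame_rules :: "bfm mrule set" where
  "frame_rules = {(\<Gamma>, \<Delta>). \<forall>V. admissible X V \<longrightarrow> (\<forall>\<gamma>. \<gamma> |\<in>| \<Gamma> \<longrightarrow> extent X V \<gamma> = X) \<longrightarrow>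
     (\<exists>\<delta>. \<delta> |\<in>| \<Delta> \<and> extent X V \<delta> = X)}"

definition frame_logic :: "bfm set" where
  "frame_logic = {\<phi>. \<forall>V. admissible X V \<longrightarrow> extent X V \<phi> = X}"

lemma extent_eq_iff: "extent X V \<phi> = X \<longleftrightarrow> (\<forall>x\<in>X. x \<in> extent X V \<phi>)"
  using extent_subset[of X V \<phi>] by blast

lemma extent_imp: "extent X V (BImp \<phi> \<psi>) = X \<longleftrightarrow> extent X V \<phi> \<subseteq> extent X V \<psi>"
  using extent_subset[of X V] by auto

lemma in_extent_imp: "x \<in> extent X V (BImp \<phi> \<psi>) \<longleftrightarrow> x \<in> X \<and> (x \<in> extent X V \<phi> \<longrightarrow> x \<in> extent X V \<psi>)"
  using extent_subset[of X V \<psi>] by auto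

lemma in_extent_I: "x \<in> extent X V (BoxI \<phi>) \<longleftrightarrow> x \<in> X \<and> (\<forall>y\<in>X. x \<subseteq> y \<longrightarrow> y \<in> extent X V \<phi>)"
  by simp

lemma admissible_bsubst: "admissible X V \<Longrightarrow> admissible X (\<lambda>p. extent X V (s p))"
  by (simp add: admissible_def extent_finitely_determined)

lemma bim_logic_frame_logic: "bim_logic frame_logic"
proof (rule bim_logicI)
  show "bsubst s \<phi> \<in> frame_logic" if "\<phi> \<in> frame_logic" for s \<phi>
    using that by (simp add: frame_logic_def extent_bsubst admissible_bsubst)
  show "CPC \<subseteq> frame_logic"
    unfolding CPC_def frame_logic_def extent_eq_iff using ceval_extent by blast
  show "\<psi> \<in> frame_logic" if "BImp \<phi> \<psi> \<in> frame_logic" "\<phi> \<in> frame_logic" for \<phi> \<psi>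
    using that extent_subset unfolding frame_logic_def mem_Collect_eq extent_imp by blast
  show "BImp (BoxI \<phi>) (BoxI \<psi>) \<in> frame_logic" "BImp (BoxM \<phi>) (BoxM \<psi>) \<in> frame_logic"
    if "BImp \<phi> \<psi> \<in> frame_logic" for \<phi> \<psi>
    using that unfolding frame_logic_def mem_Collect_eq extent_imp by auto
qed (auto simp: frame_logic_def)

lemma GrzKMix_subset_frame_logic: "GrzKMix \<subseteq> frame_logic"
  unfolding GrzKMix_subset_iff[OF bim_logic_frame_logic]
proof (intro conjI)
  show "BImp (BoxI (BVar 0)) (BVar 0) \<in> frame_logic"
    unfolding frame_logic_def mem_Collect_eq extent_imp by auto
  show "BImp (BoxI (BVar 0)) (BoxI (BoxI (BVar 0))) \<in> frame_logic"
    unfolding frame_logic_def mem_Collect_eq extent_imp by auto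
  show "BImp (BoxI (BImp (BoxI (BImp (BVar 0) (BoxI (BVar 0)))) (BVar 0))) (BVar 0) \<in> frame_logic"
    unfolding frame_logic_def mem_Collect_eq extent_imp
  proof (intro allI impI subsetI)
    fix V x
    let ?p = "BVar 0"
    assume V: "admissible X V"
      and x: "x \<in> extent X V (BoxI (BImp (BoxI (BImp ?p (BoxI ?p))) ?p))"
    have "x \<in> X" using x extent_subset by blast
    show "x \<in> extent X V ?p"
    proof (rule extent_Grz[OF extent_finitely_determined[OF V] \<open>x \<in> X\<close>])
      fix y assume y: "y \<in> X" "x \<subseteq> y"
        and persist: "\<forall>z\<in>X. y \<subseteq> z \<longrightarrow> z \<in> extent X V ?p \<longrightarrow>
          (\<forall>w\<in>X. z \<subseteq> w \<longrightarrow> w \<in> extent X V ?p)"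
      have "z \<in> extent X V (BImp ?p (BoxI ?p))" if "z \<in> X" "y \<subseteq> z" for z
        using persist[rule_format, OF that] that unfolding in_extent_imp in_extent_I by simp
      then have "y \<in> extent X V (BoxI (BImp ?p (BoxI ?p)))"
        using y(1) in_extent_I by blast
      moreover have "y \<in> extent X V (BImp (BoxI (BImp ?p (BoxI ?p))) ?p)"
        using x y in_extent_I by blast
      ultimately show "y \<in> extent X V ?p" using in_extent_imp by blast
    qed
  qed
  show "Mix \<in> frame_logic"
    unfolding frame_logic_def Mix_def mem_Collect_eq extent.simps(5)
  proof (intro allI impI)
    fix V
    have "extent X V (BoxI (BoxM (BoxI (BVar 0)))) = extent X V (BoxM (BVar 0))"
      using extent_Mix[of _ "V 0 \<inter> X"] by auto
    then have "extent X V (BImp (BoxI (BoxM (BoxI (BVar 0)))) (BoxM (BVar 0))) = X"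
      "extent X V (BImp (BoxM (BVar 0)) (BoxI (BoxM (BoxI (BVar 0))))) = X"
      by (simp_all only: extent_imp order_refl)
    then show "extent X V (BImp (BoxI (BoxM (BoxI (BVar 0)))) (BoxM (BVar 0))) \<inter>
        extent X V (BImp (BoxM (BVar 0)) (BoxI (BoxM (BoxI (BVar 0))))) = X"
      by (simp only: Int_absorb)
  qed
qed

lemma bim_conseq_frame_rules: "bim_conseq frame_rules"
  unfolding bim_conseq_def
proof (intro conjI allI ballI)
  show "mc_conseq bsubst frame_rules"
  proof (rule mc_conseqI)
    show "(bsubst s |`| \<Gamma>, bsubst s |`| \<Delta>) \<in> frame_rules" if rule: "(\<Gamma>, \<Delta>) \<in> frame_rules" for s \<Gamma> \<Delta>
      unfolding frame_rules_def mem_Collect_eq prod.case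
    proof (intro allI impI)
      fix V assume V: "admissible X V" and "\<forall>\<gamma>. \<gamma> |\<in>| bsubst s |`| \<Gamma> \<longrightarrow> extent X V \<gamma> = X"
      then have "\<forall>\<gamma>. \<gamma> |\<in>| \<Gamma> \<longrightarrow> extent X (\<lambda>p. extent X V (s p)) \<gamma> = X"
        by (simp flip: extent_bsubst)
      then obtain \<delta> where "\<delta> |\<in>| \<Delta>" "extent X (\<lambda>p. extent X V (s p)) \<delta> = X"
        using rule admissible_bsubst[OF V, of s] unfolding frame_rules_def by blast
      then show "\<exists>\<delta>. \<delta> |\<in>| bsubst s |`| \<Delta> \<and> extent X V \<delta> = X"
        by (intro exI[of _ "bsubst s \<delta>"]) (simp add: extent_bsubst)
    qed
  qed (fastforce simp: frame_rules_def)+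
  show "axiom_rule \<phi> \<in> frame_rules" if "\<phi> \<in> KK" for \<phi>
  proof -
    have "KK \<subseteq> frame_logic" unfolding KK_def by (rule hull_minimal) (simp_all add: bim_logic_frame_logic)
    then show ?thesis using that by (auto simp: frame_logic_def frame_rules_def)
  qed
  show "({|BImp \<phi> \<psi>, \<phi>|}, {|\<psi>|}) \<in> frame_rules" for \<phi> \<psi>
    unfolding frame_rules_def mem_Collect_eq prod.case
  proof (intro allI impI)
    fix V assume "\<forall>\<gamma>. \<gamma> |\<in>| {|BImp \<phi> \<psi>, \<phi>|} \<longrightarrow> extent X V \<gamma> = X"
    then have "extent X V (BImp \<phi> \<psi>) = X" "extent X V \<phi> = X" by blast+
    then have "extent X V \<psi> = X" using extent_imp extent_subset by blast
    then show "\<exists>\<delta>. \<delta> |\<in>| {|\<psi>|} \<and> extent X V \<delta> = X" by simp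
  qed
qed (auto simp: frame_rules_def)

lemma GrzKMix_rel_subset_frame_rules: "GrzKMix_rel \<subseteq> frame_rules"
  unfolding GrzKMix_rel_def logic_rel_def
  by (rule hull_minimal)
    (use GrzKMix_subset_frame_logic bim_conseq_frame_rules in \<open>auto simp: frame_logic_def frame_rules_def\<close>)

lemma extent_I_theory:
  assumes "extent X V \<phi> = {x \<in> X. \<chi> \<in> x}"
  shows "extent X V (BoxI \<phi>) = {x \<in> X. \<chi> \<in> x}"
  unfolding extent.simps assms by blast

lemma extent_godel:
  assumes "\<And>p. extent X V (BoxI (BVar p)) = {x \<in> X. s p \<in> x}"
  shows "extent X V (godel \<phi>) = {x \<in> X. isubst s \<phi> \<in> x}"
proof (induction \<phi>)
  case (IVar p)
  show ?case unfolding godel.simps isubst.simps by (rule assms)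
next
  case ITop
  show ?case unfolding godel.simps isubst.simps
    by (rule extent_I_theory, unfold extent.simps) (use prime_top in blast)
next
  case IBot
  show ?case unfolding godel.simps isubst.simps
    by (rule extent_I_theory, unfold extent.simps) (use prime_bot in blast)
next
  case (IAnd \<phi> \<psi>)
  show ?case unfolding godel.simps isubst.simps
    by (rule extent_I_theory, unfold extent.simps IAnd) (use prime_and in blast)
next
  case (IOr \<phi> \<psi>)
  show ?case unfolding godel.simps isubst.simps
    by (rule extent_I_theory, unfold extent.simps IOr) (use prime_or in blast)
next
  case (IImp \<phi> \<psi>)
  show ?case
    unfolding godel.simps isubst.simps
  proof (rule set_eqI)
    show "x \<in> extent X V (BoxI (BImp (godel \<phi>) (godel \<psi>))) \<longleftrightarrow>
        x \<in> {x \<in> X. IImp (isubst s \<phi>) (isubst s \<psi>) \<in> x}" for x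
      unfolding in_extent_I in_extent_imp IImp mem_Collect_eq
      using prime_imp[of x "isubst s \<phi>" "isubst s \<psi>"] by blast
  qed
next
  case (IBox \<phi>)
  show ?case unfolding godel.simps isubst.simps
    by (rule extent_I_theory, unfold extent.simps IBox) (use prime_box in blast)
qed

lemma extent_godel_eq_iff:
  assumes "\<And>p. extent X V (BoxI (BVar p)) = {x \<in> X. s p \<in> x}"
  shows "extent X V (godel \<phi>) = X \<longleftrightarrow> isubst s \<phi> \<in> T"
  by (auto simp: extent_godel[OF assms] in_theory_iff)

text \<open>Under an admissible valuation the interior of each variable is given by a formula, so
  translations evaluate to substitution instances of intuitionistic formulas. This makes
  translated rules of \<open>L\<close> valid, as \<open>L\<close> is closed under substitution.\<close>

lemma admissible_godel:
  assumes "admissible X V"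
  obtains s where "\<And>\<phi>. extent X V (godel \<phi>) = X \<longleftrightarrow> isubst s \<phi> \<in> T"
proof -
  have "\<forall>p. \<exists>\<phi>. \<forall>x\<in>X. \<phi> \<in> x \<longleftrightarrow> (\<forall>y\<in>X. x \<subseteq> y \<longrightarrow> y \<in> extent X V (BVar p))"
    using interior_representable extent_finitely_determined[OF assms] by blast
  from choice[OF this] obtain s where
    s: "\<forall>p. \<forall>x\<in>X. s p \<in> x \<longleftrightarrow> (\<forall>y\<in>X. x \<subseteq> y \<longrightarrow> y \<in> extent X V (BVar p))"
    by (elim exE)
  have "extent X V (BoxI (BVar p)) = {x \<in> X. s p \<in> x}" for p
    unfolding extent.simps(7) by (rule Collect_cong) (use s[rule_format, of _ p] in meson)
  then show thesis by (intro that[of s] extent_godel_eq_iff)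
qed

lemma isubst_IVar: "isubst IVar \<phi> = \<phi>"
  by (induction \<phi>) simp_all

lemma canonical_valuation:
  obtains V where "admissible X V" "\<And>\<phi>. extent X V (godel \<phi>) = X \<longleftrightarrow> \<phi> \<in> T"
proof
  let ?V = "\<lambda>p. {x \<in> X. IVar p \<in> x}"
  show "admissible X ?V" by (simp add: admissible_def finitely_determined_theory)
  show "extent X ?V (godel \<phi>) = X \<longleftrightarrow> \<phi> \<in> T" for \<phi>
    using extent_godel_eq_iff[of ?V IVar \<phi>] by (auto simp: isubst_IVar)
qed

end


section \<open>Pulling bimodal theories back along the Goedel translation\<close>

text \<open>The common features of the bimodal logics considered here and of the saturated sets of the
  bimodal consequence relations; the latter
  need not be closed under substitution.\<close>

locale bim_theory =
  fixes T :: "bfm set"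
  assumes GrzKMix_subset: "GrzKMix \<subseteq> T"
    and mp: "BImp \<phi> \<psi> \<in> T \<Longrightarrow> \<phi> \<in> T \<Longrightarrow> \<psi> \<in> T"
    and I_nec: "\<phi> \<in> T \<Longrightarrow> BoxI \<phi> \<in> T"
    and M_nec: "\<phi> \<in> T \<Longrightarrow> BoxM \<phi> \<in> T"
begin

lemma I_iff: "BoxI \<phi> \<in> T \<longleftrightarrow> \<phi> \<in> T"
  using I_nec mp GrzKMix_T GrzKMix_subset by blast

lemma interior_equiv_iff:
  assumes "interior_equiv \<phi> \<psi>"
  shows "\<phi> \<in> T \<longleftrightarrow> \<psi> \<in> T"
proof -
  have iff: "BIff (BoxI \<phi>) (BoxI \<psi>) \<in> GrzKMix"
    using assms by (simp add: interior_equiv_def lind_I.abs_eq abs_lind_eq_iff)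
  have "BImp (BoxI \<phi>) (BoxI \<psi>) \<in> GrzKMix" "BImp (BoxI \<psi>) (BoxI \<phi>) \<in> GrzKMix"
    by (rule GrzKMix_cpc1[OF iff], unfold ceval.simps, blast)+
  then have "BoxI \<phi> \<in> T \<longleftrightarrow> BoxI \<psi> \<in> T" using mp GrzKMix_subset by blast
  then show ?thesis by (simp only: I_iff)
qed

lemma godel_mp: "godel (IImp \<phi> \<psi>) \<in> T \<Longrightarrow> godel \<phi> \<in> T \<Longrightarrow> godel \<psi> \<in> T"
  unfolding godel.simps I_iff by (rule mp)

lemma godel_nec: "godel \<phi> \<in> T \<Longrightarrow> godel (IBox \<phi>) \<in> T"
  unfolding godel.simps I_iff by (rule M_nec)

end

lemma bim_theory_logic:
  assumes "M \<in> NExt bim_logic GrzKMix"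
  shows "bim_theory M"
proof -
  have M: "bim_logic M" "GrzKMix \<subseteq> M" using assms by (simp_all add: NExt_def)
  show ?thesis
    by unfold_locales (use M(2) bim_logicD[OF M(1)] in blast)+
qed

lemma GrzKMix_rel_axiom: "\<phi> \<in> GrzKMix \<Longrightarrow> axiom_rule \<phi> \<in> GrzKMix_rel"
  unfolding GrzKMix_rel_def logic_rel_def by (rule hull_inc) (rule imageI)

lemma bim_theory_saturated:
  assumes "M \<in> NExt bim_conseq GrzKMix_rel" and sat: "saturated M T"
  shows "bim_theory T"
proof -
  have M: "bim_conseq M" "GrzKMix_rel \<subseteq> M" using assms by (simp_all add: NExt_def)
  show ?thesis
  proof
    show "GrzKMix \<subseteq> T"
      using GrzKMix_rel_axiom M(2) saturated_axiom[OF sat] by blast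
  qed (rule saturated_bim_conseq[OF M(1) sat]; assumption)+
qed

lemma interior_equiv_isubst:
  "interior_equiv (bsubst (\<lambda>p. godel (s p)) (godel \<phi>)) (godel (isubst s \<phi>))"
  using lind_godel_isubst[of s \<phi>] by (simp add: interior_equiv_def lind_godel_def)

text \<open>Necessitation and modus ponens for translations come from those of \<open>M\<close> because a box in
  front of a member can be added and removed.\<close>

lemma int_logic_rho_logic:
  assumes M: "M \<in> NExt bim_logic GrzKMix"
  shows "int_logic (rho_logic M)"
proof -
  interpret bim_theory M using M by (rule bim_theory_logic)
  have logic: "bim_logic M" using M by (simp add: NExt_def)
  have theorem_M: "\<phi> \<in> rho_logic M" if "lind_godel \<phi> = top" for \<phi>
    using that GrzKMix_subset by (auto simp: rho_logic_def lind_godel_def abs_lind_eq_top_iff)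
  show ?thesis
  proof (rule int_logicI)
    show "isubst s \<phi> \<in> rho_logic M" if "\<phi> \<in> rho_logic M" for s \<phi>
      using bim_logic_subst[OF logic, of "godel \<phi>" "\<lambda>p. godel (s p)"] that
        interior_equiv_iff[OF interior_equiv_isubst[of s \<phi>]] by (simp add: rho_logic_def)
    show "IPC \<subseteq> rho_logic M"
      using lind_godel_IPC theorem_M by blast
    show "IIff (IBox (IAnd \<phi> \<psi>)) (IAnd (IBox \<phi>) (IBox \<psi>)) \<in> rho_logic M" for \<phi> \<psi>
    proof (rule theorem_M)
      have "lind_godel (IBox (IAnd \<phi> \<psi>)) = lind_godel (IAnd (IBox \<phi>) (IBox \<psi>))"
        by (simp add: lind_godel_simps lind.M_inf)
      then show "lind_godel (IIff (IBox (IAnd \<phi> \<psi>)) (IAnd (IBox \<phi>) (IBox \<psi>))) = top"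
        unfolding lind_godel_simps(4)[of "IImp _ _"] by (simp add: lind_godel_imp_top)
    qed
    show "\<psi> \<in> rho_logic M" if "IImp \<phi> \<psi> \<in> rho_logic M" "\<phi> \<in> rho_logic M" for \<phi> \<psi>
      using that godel_mp unfolding rho_logic_def by blast
    show "IImp (IBox \<phi>) (IBox \<psi>) \<in> rho_logic M" if "IImp \<phi> \<psi> \<in> rho_logic M" for \<phi> \<psi>
    proof -
      have "BImp (godel \<phi>) (godel \<psi>) \<in> M" using that by (simp add: rho_logic_def I_iff)
      then have "BImp (BoxI (BoxM (godel \<phi>))) (BoxI (BoxM (godel \<psi>))) \<in> M"
        by (intro bim_logic_I_mono[OF logic] bim_logic_M_mono[OF logic])
      then show ?thesis by (simp add: rho_logic_def I_iff)
    qed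
    show "IBox \<phi> \<in> rho_logic M" if "\<phi> \<in> rho_logic M" for \<phi>
      using that godel_nec unfolding rho_logic_def by blast
  qed
qed

lemma IntK_subset_rho_logic: "IntK \<subseteq> rho_logic GrzKMix"
  unfolding IntK_def
  by (rule hull_minimal) (use int_logic_rho_logic bim_logic_GrzKMix in \<open>auto simp: NExt_def\<close>)

text \<open>A saturated set cannot distinguish formulas with the same interior, and consequence
  relations are determined by their saturated sets.\<close>

lemma bim_conseq_replace:
  assumes M: "M \<in> NExt bim_conseq GrzKMix_rel"
    and rule: "(f |`| \<Gamma>, f |`| \<Delta>) \<in> M"
    and equiv: "\<And>\<phi>. \<phi> |\<in>| \<Gamma> \<or> \<phi> |\<in>| \<Delta> \<Longrightarrow> interior_equiv (f \<phi>) (g \<phi>)"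
  shows "(g |`| \<Gamma>, g |`| \<Delta>) \<in> M"
proof (rule mc_conseq_if_saturated)
  show "mc_conseq bsubst M" using M by (simp add: NExt_def bim_conseq_def)
  fix T assume sat: "saturated M T" and sub: "fset (g |`| \<Gamma>) \<subseteq> T"
  interpret bim_theory T using M sat by (rule bim_theory_saturated)
  have iff: "f \<phi> \<in> T \<longleftrightarrow> g \<phi> \<in> T" if "\<phi> |\<in>| \<Gamma> \<or> \<phi> |\<in>| \<Delta>" for \<phi>
    using equiv[OF that] by (rule interior_equiv_iff)
  have "fset (f |`| \<Gamma>) \<subseteq> T" using sub iff by auto
  then obtain \<delta> where "\<delta> |\<in>| \<Delta>" "f \<delta> \<in> T" using saturatedD[OF sat rule] by auto
  then show "\<exists>\<delta>. \<delta> |\<in>| g |`| \<Delta> \<and> \<delta> \<in> T" using iff by auto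
qed

lemma int_conseq_rho_rel:
  assumes M: "M \<in> NExt bim_conseq GrzKMix_rel"
  shows "int_conseq (rho_rel M)"
proof -
  have mc: "mc_conseq bsubst M" and sub: "GrzKMix_rel \<subseteq> M"
    using M by (simp_all add: NExt_def bim_conseq_def)
  have rho: "(\<Gamma>, \<Delta>) \<in> rho_rel M \<longleftrightarrow> (godel |`| \<Gamma>, godel |`| \<Delta>) \<in> M" for \<Gamma> \<Delta>
    by (simp add: rho_rel_def)
  show ?thesis
    unfolding int_conseq_def
  proof (intro conjI ballI allI)
    show "mc_conseq isubst (rho_rel M)"
    proof (rule mc_conseqI)
      show "(isubst s |`| \<Gamma>, isubst s |`| \<Delta>) \<in> rho_rel M" if "(\<Gamma>, \<Delta>) \<in> rho_rel M" for s \<Gamma> \<Delta>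
      proof -
        let ?s = "\<lambda>p. godel (s p)"
        have "(bsubst ?s |`| godel |`| \<Gamma>, bsubst ?s |`| godel |`| \<Delta>) \<in> M"
          using mc_conseq_subst[OF mc, of "(godel |`| \<Gamma>, godel |`| \<Delta>)" ?s] that by (simp add: rho)
        then have "((\<lambda>\<phi>. bsubst ?s (godel \<phi>)) |`| \<Gamma>, (\<lambda>\<phi>. bsubst ?s (godel \<phi>)) |`| \<Delta>) \<in> M"
          by (simp add: fset.map_comp comp_def)
        then have "((\<lambda>\<phi>. godel (isubst s \<phi>)) |`| \<Gamma>, (\<lambda>\<phi>. godel (isubst s \<phi>)) |`| \<Delta>) \<in> M"
          by (rule bim_conseq_replace[OF M]) (rule interior_equiv_isubst)
        then show ?thesis by (simp add: rho fset.map_comp comp_def)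
      qed
      show "({|\<phi>|}, {|\<phi>|}) \<in> rho_rel M" for \<phi>
        by (simp add: rho mc_conseq_refl[OF mc])
      show "(\<Gamma> |\<union>| \<Gamma>', \<Delta> |\<union>| \<Delta>') \<in> rho_rel M" if "(\<Gamma>, \<Delta>) \<in> rho_rel M" for \<Gamma> \<Delta> \<Gamma>' \<Delta>'
        using mc_conseq_weaken[OF mc] that by (simp add: rho fimage_funion)
      show "(\<Gamma>, \<Delta>) \<in> rho_rel M"
        if "(\<Gamma>, \<Delta> |\<union>| {|\<phi>|}) \<in> rho_rel M" "(\<Gamma> |\<union>| {|\<phi>|}, \<Delta>) \<in> rho_rel M" for \<Gamma> \<Delta> \<phi>
        using mc_conseq_cut[OF mc, of "godel |`| \<Gamma>" "godel |`| \<Delta>" "godel \<phi>"] that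
        by (simp add: rho fimage_funion)
    qed
    show "axiom_rule \<phi> \<in> rho_rel M" if "\<phi> \<in> IntK" for \<phi>
      using that IntK_subset_rho_logic GrzKMix_rel_axiom sub by (auto simp: rho rho_logic_def)
    show "({|IImp \<phi> \<psi>, \<phi>|}, {|\<psi>|}) \<in> rho_rel M" for \<phi> \<psi>
      unfolding rho
    proof (rule mc_conseq_if_saturated[OF mc])
      fix T assume sat: "saturated M T" and "fset (godel |`| {|IImp \<phi> \<psi>, \<phi>|}) \<subseteq> T"
      then have "godel (IImp \<phi> \<psi>) \<in> T" "godel \<phi> \<in> T" by (simp_all del: godel.simps)
      then have "godel \<psi> \<in> T" by (rule bim_theory.godel_mp[OF bim_theory_saturated[OF M sat]])
      then show "\<exists>\<delta>. \<delta> |\<in>| godel |`| {|\<psi>|} \<and> \<delta> \<in> T" by simp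
    qed
    show "({|\<phi>|}, {|IBox \<phi>|}) \<in> rho_rel M" for \<phi>
      unfolding rho
    proof (rule mc_conseq_if_saturated[OF mc])
      fix T assume sat: "saturated M T" and "fset (godel |`| {|\<phi>|}) \<subseteq> T"
      then have "godel \<phi> \<in> T" by simp
      then have "godel (IBox \<phi>) \<in> T" by (rule bim_theory.godel_nec[OF bim_theory_saturated[OF M sat]])
      then show "\<exists>\<delta>. \<delta> |\<in>| godel |`| {|IBox \<phi>|} \<and> \<delta> \<in> T" by (simp del: godel.simps)
    qed
  qed
qed


section \<open>The two maps are mutually inverse\<close>

lemma oplus_in_NExt:
  assumes "\<And>\<X>. (\<And>X. X \<in> \<X> \<Longrightarrow> P X) \<Longrightarrow> P (\<Inter>\<X>)"
  shows "oplus P A B \<in> NExt P A"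
proof -
  have "P (oplus P A B)" unfolding oplus_def by (rule hull_in) (simp add: assms)
  moreover have "A \<subseteq> oplus P A B" unfolding oplus_def by (meson hull_subset le_sup_iff)
  ultimately show ?thesis by (simp add: NExt_def)
qed

lemma oplus_right: "B \<subseteq> oplus P A B"
  unfolding oplus_def by (meson hull_subset le_sup_iff)

lemma oplus_least: "M \<in> NExt P A \<Longrightarrow> B \<subseteq> M \<Longrightarrow> oplus P A B \<subseteq> M"
  unfolding oplus_def NExt_def by (rule hull_minimal) simp_all

lemma sigma_logic_NExt: "sigma_logic L \<in> NExt bim_logic GrzKMix"
  unfolding sigma_logic_def by (rule oplus_in_NExt) (rule bim_logic_Inter)

lemma sigma_rel_NExt: "sigma_rel L \<in> NExt bim_conseq GrzKMix_rel"
  unfolding sigma_rel_def by (rule oplus_in_NExt) (rule bim_conseq_Inter)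

lemma rho_logic_NExt: "M \<in> NExt bim_logic GrzKMix \<Longrightarrow> rho_logic M \<in> NExt int_logic IntK"
  using int_logic_rho_logic hull_minimal[of "{}" "rho_logic M" int_logic]
  by (simp add: NExt_def IntK_def)

lemma rho_rel_NExt:
  assumes "M \<in> NExt bim_conseq GrzKMix_rel"
  shows "rho_rel M \<in> NExt int_conseq IntK_rel"
proof -
  have conseq: "int_conseq (rho_rel M)" using assms by (rule int_conseq_rho_rel)
  then have "axiom_rule ` IntK \<subseteq> rho_rel M" unfolding int_conseq_def by blast
  then have "IntK_rel \<subseteq> rho_rel M"
    unfolding IntK_rel_def logic_rel_def using conseq by (rule hull_minimal)
  then show ?thesis using conseq by (simp add: NExt_def)
qed

lemma sigma_rho_logic:
  assumes M: "M \<in> NExt bim_logic GrzKMix"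
  shows "sigma_logic (rho_logic M) = M"
proof
  show "sigma_logic (rho_logic M) \<subseteq> M"
    unfolding sigma_logic_def by (rule oplus_least[OF M]) (auto simp: rho_logic_def)
  let ?N = "sigma_logic (rho_logic M)"
  have N: "?N \<in> NExt bim_logic GrzKMix" by (rule sigma_logic_NExt)
  have logics: "bim_logic M" "bim_logic ?N" using M N by (simp_all add: NExt_def)
  interpret M: bim_theory M using M by (rule bim_theory_logic)
  interpret N: bim_theory ?N using N by (rule bim_theory_logic)
  show "M \<subseteq> ?N"
  proof
    fix \<phi> assume "\<phi> \<in> M"
    obtain s1 s2 f where red: "\<And>\<phi>. interior_equiv (bsubst s1 \<phi>) (godel (f \<phi>))"
        "interior_equiv (bsubst s2 (bsubst s1 \<phi>)) \<phi>"
      using reduction_to_godel[of "{\<phi>}"] by auto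
    \<comment> \<open>The translation \<open>godel (f \<phi>)\<close> is the link by which \<open>\<phi>\<close> passes from \<open>M\<close> to \<open>?N\<close>.\<close>
    have "bsubst s1 \<phi> \<in> M" using \<open>\<phi> \<in> M\<close> by (rule bim_logic_subst[OF logics(1)])
    then have "godel (f \<phi>) \<in> M" by (simp only: M.interior_equiv_iff[OF red(1)])
    then have "f \<phi> \<in> rho_logic M" by (simp add: rho_logic_def)
    then have "godel (f \<phi>) \<in> ?N" unfolding sigma_logic_def by (intro subsetD[OF oplus_right]) blast
    then have "bsubst s1 \<phi> \<in> ?N" by (simp only: N.interior_equiv_iff[OF red(1)])
    then have "bsubst s2 (bsubst s1 \<phi>) \<in> ?N" by (rule bim_logic_subst[OF logics(2)])
    then show "\<phi> \<in> ?N" by (simp only: N.interior_equiv_iff[OF red(2)])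
  qed
qed

lemma sigma_rho_rel:
  assumes M: "M \<in> NExt bim_conseq GrzKMix_rel"
  shows "sigma_rel (rho_rel M) = M"
proof
  show "sigma_rel (rho_rel M) \<subseteq> M"
    unfolding sigma_rel_def by (rule oplus_least[OF M]) (auto simp: rho_rel_def)
  let ?N = "sigma_rel (rho_rel M)"
  have N: "?N \<in> NExt bim_conseq GrzKMix_rel" by (rule sigma_rel_NExt)
  have mc: "mc_conseq bsubst M" "mc_conseq bsubst ?N"
    using M N by (simp_all add: NExt_def bim_conseq_def)
  show "M \<subseteq> ?N"
  proof
    fix r assume "r \<in> M"
    obtain \<Gamma> \<Delta> where r: "r = (\<Gamma>, \<Delta>)" by (rule prod.exhaust)
    have "finite (fset \<Gamma> \<union> fset \<Delta>)" by simp
    from reduction_to_godel[OF this] obtain s1 s2 f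
      where red: "\<And>\<phi>. interior_equiv (bsubst s1 \<phi>) (godel (f \<phi>))"
        "\<forall>\<phi>\<in>fset \<Gamma> \<union> fset \<Delta>. interior_equiv (bsubst s2 (bsubst s1 \<phi>)) \<phi>"
      by blast
    have red': "interior_equiv (godel (f \<phi>)) (bsubst s1 \<phi>)" for \<phi>
      using red(1)[of \<phi>] by (simp add: interior_equiv_def)
    have "(bsubst s1 |`| \<Gamma>, bsubst s1 |`| \<Delta>) \<in> M"
      using mc_conseq_subst[OF mc(1) \<open>r \<in> M\<close>, of s1] by (simp add: r)
    then have "((\<lambda>\<phi>. godel (f \<phi>)) |`| \<Gamma>, (\<lambda>\<phi>. godel (f \<phi>)) |`| \<Delta>) \<in> M"
      by (rule bim_conseq_replace[OF M]) (rule red(1))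
    then have "(f |`| \<Gamma>, f |`| \<Delta>) \<in> rho_rel M"
      by (simp add: rho_rel_def fset.map_comp comp_def)
    then have "map_rule godel (f |`| \<Gamma>, f |`| \<Delta>) \<in> ?N"
      unfolding sigma_rel_def by (intro subsetD[OF oplus_right]) blast
    then have "((\<lambda>\<phi>. godel (f \<phi>)) |`| \<Gamma>, (\<lambda>\<phi>. godel (f \<phi>)) |`| \<Delta>) \<in> ?N"
      by (simp add: fset.map_comp comp_def)
    then have "(bsubst s1 |`| \<Gamma>, bsubst s1 |`| \<Delta>) \<in> ?N"
      by (rule bim_conseq_replace[OF N]) (rule red')
    then have "map_rule (bsubst s2) (bsubst s1 |`| \<Gamma>, bsubst s1 |`| \<Delta>) \<in> ?N"
      by (rule mc_conseq_subst[OF mc(2)])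
    then have "((\<lambda>\<phi>. bsubst s2 (bsubst s1 \<phi>)) |`| \<Gamma>, (\<lambda>\<phi>. bsubst s2 (bsubst s1 \<phi>)) |`| \<Delta>) \<in> ?N"
      by (simp add: fset.map_comp comp_def)
    then have "((\<lambda>\<phi>. \<phi>) |`| \<Gamma>, (\<lambda>\<phi>. \<phi>) |`| \<Delta>) \<in> ?N"
      by (rule bim_conseq_replace[OF N]) (use red(2) in blast)
    then show "r \<in> ?N" by (simp add: r)
  qed
qed

text \<open>The logic of the frame of prime theories above \<open>L\<close> contains the translations of \<open>L\<close>, hence all of
  \<open>\<sigma>(L)\<close>, but it refutes the translation of every formula outside \<open>L\<close>.\<close>

lemma rho_sigma_logic:
  assumes L: "L \<in> NExt int_logic IntK"
  shows "rho_logic (sigma_logic L) = L"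
proof
  have logic: "int_logic L" and "IntK \<subseteq> L" using L by (simp_all add: NExt_def)
  then interpret int_theory L by unfold_locales (use int_logicD in blast)+
  show "L \<subseteq> rho_logic (sigma_logic L)"
    using oplus_right by (fastforce simp: rho_logic_def sigma_logic_def)
  have "sigma_logic L \<subseteq> frame_logic"
    unfolding sigma_logic_def
  proof (rule oplus_least)
    show "frame_logic \<in> NExt bim_logic GrzKMix"
      by (simp add: NExt_def bim_logic_frame_logic GrzKMix_subset_frame_logic)
    show "{godel \<phi> |\<phi>. \<phi> \<in> L} \<subseteq> frame_logic"
    proof clarify
      fix \<phi> assume "\<phi> \<in> L"
      show "godel \<phi> \<in> frame_logic"
        unfolding frame_logic_def mem_Collect_eq
      proof (intro allI impI)
        fix V assume "admissible X V"
        then obtain s where "\<And>\<phi>. extent X V (godel \<phi>) = X \<longleftrightarrow> isubst s \<phi> \<in> L"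
          by (rule admissible_godel) (rule that)
        then show "extent X V (godel \<phi>) = X"
          using int_logic_subst[OF logic \<open>\<phi> \<in> L\<close>] by simp
      qed
    qed
  qed
  moreover obtain V where "admissible X V" "\<And>\<phi>. extent X V (godel \<phi>) = X \<longleftrightarrow> \<phi> \<in> L"
    by (rule canonical_valuation) (rule that)
  ultimately show "rho_logic (sigma_logic L) \<subseteq> L"
    unfolding rho_logic_def frame_logic_def by blast
qed

text \<open>A rule outside \<open>L\<close> is refuted by a saturated set \<open>T\<close>. The rules valid in the frame of prime
  theories above \<open>T\<close> contain \<open>\<sigma>(L)\<close>, while the canonical valuation refutes the translated rule.\<close>

lemma rho_sigma_rel:
  assumes L: "L \<in> NExt int_conseq IntK_rel"
  shows "rho_rel (sigma_rel L) = L"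
proof
  have conseq: "int_conseq L" using L by (simp add: NExt_def)
  then have mc: "mc_conseq isubst L" by (simp add: int_conseq_def)
  show "L \<subseteq> rho_rel (sigma_rel L)"
    using oplus_right by (fastforce simp: rho_rel_def sigma_rel_def)
  show "rho_rel (sigma_rel L) \<subseteq> L"
  proof
    fix r assume "r \<in> rho_rel (sigma_rel L)"
    obtain \<Gamma> \<Delta> where r: "r = (\<Gamma>, \<Delta>)" by (rule prod.exhaust)
    then have rule: "(godel |`| \<Gamma>, godel |`| \<Delta>) \<in> sigma_rel L"
      using \<open>r \<in> rho_rel (sigma_rel L)\<close> by (simp add: rho_rel_def)
    have "(\<Gamma>, \<Delta>) \<in> L"
    proof (rule mc_conseq_if_saturated[OF mc])
      fix T assume sat: "saturated L T" and sub: "fset \<Gamma> \<subseteq> T"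
      interpret int_theory T
        by unfold_locales (rule saturated_int_conseq[OF conseq sat]; assumption)+
      have "sigma_rel L \<subseteq> frame_rules"
        unfolding sigma_rel_def
      proof (rule oplus_least)
        show "frame_rules \<in> NExt bim_conseq GrzKMix_rel"
          by (simp add: NExt_def bim_conseq_frame_rules GrzKMix_rel_subset_frame_rules)
        show "{map_rule godel r |r. r \<in> L} \<subseteq> frame_rules"
        proof
          fix r' assume "r' \<in> {map_rule godel r |r. r \<in> L}"
          then obtain \<Gamma> \<Delta> where "(\<Gamma>, \<Delta>) \<in> L" and r': "r' = (godel |`| \<Gamma>, godel |`| \<Delta>)" by auto
          have "(godel |`| \<Gamma>, godel |`| \<Delta>) \<in> frame_rules"
            unfolding frame_rules_def mem_Collect_eq prod.case
          proof (intro allI impI)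
            fix V assume "admissible X V" and prem: "\<forall>\<gamma>. \<gamma> |\<in>| godel |`| \<Gamma> \<longrightarrow> extent X V \<gamma> = X"
            then obtain s where s: "\<And>\<phi>. extent X V (godel \<phi>) = X \<longleftrightarrow> isubst s \<phi> \<in> T"
              by (elim admissible_godel) (rule that)
            have "(isubst s |`| \<Gamma>, isubst s |`| \<Delta>) \<in> L"
              using mc_conseq_subst[OF mc \<open>(\<Gamma>, \<Delta>) \<in> L\<close>, of s] by simp
            moreover have "fset (isubst s |`| \<Gamma>) \<subseteq> T" using prem s by auto
            ultimately have "\<exists>\<delta>. \<delta> |\<in>| isubst s |`| \<Delta> \<and> \<delta> \<in> T" by (rule saturatedD[OF sat])
            then show "\<exists>\<delta>. \<delta> |\<in>| godel |`| \<Delta> \<and> extent X V \<delta> = X" using s by auto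
          qed
          then show "r' \<in> frame_rules" by (simp only: r')
        qed
      qed
      then have rule': "(godel |`| \<Gamma>, godel |`| \<Delta>) \<in> frame_rules" using rule by blast
      obtain V where V: "admissible X V" "\<And>\<phi>. extent X V (godel \<phi>) = X \<longleftrightarrow> \<phi> \<in> T"
        by (rule canonical_valuation) (rule that)
      have "\<forall>\<gamma>. \<gamma> |\<in>| godel |`| \<Gamma> \<longrightarrow> extent X V \<gamma> = X" using sub V(2) by auto
      then have "\<exists>\<delta>. \<delta> |\<in>| godel |`| \<Delta> \<and> extent X V \<delta> = X"
        using rule' V(1) unfolding frame_rules_def by simp
      then show "\<exists>\<delta>. \<delta> |\<in>| \<Delta> \<and> \<delta> \<in> T" using V(2) by auto
    qed
    then show "r \<in> L" by (simp add: r)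
  qed
qed

lemma sigma_logic_mono: "L \<subseteq> L' \<Longrightarrow> sigma_logic L \<subseteq> sigma_logic L'"
  unfolding sigma_logic_def oplus_def by (rule hull_mono) blast

lemma sigma_rel_mono: "L \<subseteq> L' \<Longrightarrow> sigma_rel L \<subseteq> sigma_rel L'"
  unfolding sigma_rel_def oplus_def by (rule hull_mono) blast

lemma rho_logic_mono: "M \<subseteq> M' \<Longrightarrow> rho_logic M \<subseteq> rho_logic M'"
  by (auto simp: rho_logic_def)

lemma rho_rel_mono: "M \<subseteq> M' \<Longrightarrow> rho_rel M \<subseteq> rho_rel M'"
  by (auto simp: rho_rel_def)

theorem theorem4p24:
  shows "(lattice_iso int_conseq IntK_rel bim_conseq GrzKMix_rel sigma_rel \<and>
          lattice_iso bim_conseq GrzKMix_rel int_conseq IntK_rel rho_rel \<and>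
          (\<forall>L\<in>NExt int_conseq IntK_rel. rho_rel (sigma_rel L) = L) \<and>
          (\<forall>M\<in>NExt bim_conseq GrzKMix_rel. sigma_rel (rho_rel M) = M)) \<and>
         (lattice_iso int_logic IntK bim_logic GrzKMix sigma_logic \<and>
          lattice_iso bim_logic GrzKMix int_logic IntK rho_logic \<and>
          (\<forall>L\<in>NExt int_logic IntK. rho_logic (sigma_logic L) = L) \<and>
          (\<forall>M\<in>NExt bim_logic GrzKMix. sigma_logic (rho_logic M) = M))"
proof (intro conjI ballI)
  show "lattice_iso int_conseq IntK_rel bim_conseq GrzKMix_rel sigma_rel"
    by (rule lattice_iso_if_inverse[where g = rho_rel and P = int_conseq and Q = bim_conseq])
      (assumption | rule int_conseq_Inter bim_conseq_Inter sigma_rel_NExt rho_rel_NExt sigma_rel_mono rho_rel_mono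
        rho_sigma_rel sigma_rho_rel)+
  show "lattice_iso bim_conseq GrzKMix_rel int_conseq IntK_rel rho_rel"
    by (rule lattice_iso_if_inverse[where g = sigma_rel and P = bim_conseq and Q = int_conseq])
      (assumption | rule int_conseq_Inter bim_conseq_Inter sigma_rel_NExt rho_rel_NExt sigma_rel_mono rho_rel_mono
        rho_sigma_rel sigma_rho_rel)+
  show "lattice_iso int_logic IntK bim_logic GrzKMix sigma_logic"
    by (rule lattice_iso_if_inverse[where g = rho_logic and P = int_logic and Q = bim_logic])
      (assumption | rule int_logic_Inter bim_logic_Inter sigma_logic_NExt rho_logic_NExt sigma_logic_mono rho_logic_mono
        rho_sigma_logic sigma_rho_logic)+
  show "lattice_iso bim_logic GrzKMix int_logic IntK rho_logic"
    by (rule lattice_iso_if_inverse[where g = sigma_logic and P = bim_logic and Q = int_logic])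
      (assumption | rule int_logic_Inter bim_logic_Inter sigma_logic_NExt rho_logic_NExt sigma_logic_mono rho_logic_mono
        rho_sigma_logic sigma_rho_logic)+
qed (simp_all add: rho_sigma_rel sigma_rho_rel rho_sigma_logic sigma_rho_logic)

end
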